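(* Let $X$ be a UMD Banach space. Then there exists an $\alpha\in[0,\frac12)$ depending on $X$ such that for every $K_s$ there is a constant $C$ depending on $X$ and $K_s$ such that for every $T\in\mathcal{L}(X)$ which is strongly Kreiss bounded with constant $K_s$, $$\|T^n\|\le C\,n^{\alpha},\qquad n\ge1.$$
   Context: Banach spaces are over $\mathbb{C}$; $\mathcal{L}(X)$ is the space of bounded linear operators on $X$. An operator $T\in\mathcal{L}(X)$ is strongly Kreiss bounded with constant $K_s$ if every $\lambda\in\mathbb{C}$ with $|\lambda|>1$ is in the resolvent set of $T$ and $\|(\lambda-T)^{-n}\|\le K_s(|\lambda|-1)^{-n}$ for all $|\lambda|>1$ and all integers $n\ge1$. A Banach space $X$ is UMD if (equivalently to the martingale definition) the Riesz projection $\sum_n x_ne^{2\pi i nt}\mapsto\sum_{n\ge0}x_ne^{2\pi i nt}$ on $X$-valued trigonometric polynomials extends to a bounded operator on $L^p(\mathbb{T};X)$, $\mathbb{T}=[0,1]$, for some (equivalently all) $p\in(1,\infty)$. *)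

theory Defs
  imports "HOL-Analysis.Analysis"
begin

class complex_banach = banach +
  fixes scaleC :: "complex \<Rightarrow> 'a \<Rightarrow> 'a"  (infixr "*\<^sub>C" 75)
  assumes scaleC_add_right: "c *\<^sub>C (x + y) = c *\<^sub>C x + c *\<^sub>C y"
    and scaleC_add_left: "(c + d) *\<^sub>C x = c *\<^sub>C x + d *\<^sub>C x"
    and scaleC_scaleC: "c *\<^sub>C d *\<^sub>C x = (c * d) *\<^sub>C x"
    and scaleC_one: "1 *\<^sub>C x = x"
    and scaleR_scaleC: "r *\<^sub>R x = complex_of_real r *\<^sub>C x"
    and norm_scaleC: "norm (c *\<^sub>C x) = cmod c * norm x"

definition bounded_clinear :: "('a::complex_banach \<Rightarrow> 'a) \<Rightarrow> bool" where
  "bounded_clinear T \<longleftrightarrow> bounded_linear T \<and> (\<forall>c x. T (c *\<^sub>C x) = c *\<^sub>C T x)"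

definition resolvent_set :: "('a::complex_banach \<Rightarrow> 'a) \<Rightarrow> complex set" where
  "resolvent_set T = {l. \<exists>R. bounded_clinear R \<and>
     (\<forall>x. R (l *\<^sub>C x - T x) = x) \<and> (\<forall>x. l *\<^sub>C R x - T (R x) = x)}"

definition resolvent :: "('a::complex_banach \<Rightarrow> 'a) \<Rightarrow> complex \<Rightarrow> 'a \<Rightarrow> 'a" where
  "resolvent T l = inv (\<lambda>x. l *\<^sub>C x - T x)"

definition strongly_Kreiss_bounded :: "real \<Rightarrow> ('a::complex_banach \<Rightarrow> 'a) \<Rightarrow> bool" where
  "strongly_Kreiss_bounded K T \<longleftrightarrow> bounded_clinear T \<and>
     (\<forall>l. cmod l > 1 \<longrightarrow> l \<in> resolvent_set T \<and>
        (\<forall>n\<ge>1. onorm (resolvent T l ^^ n) \<le> K / (cmod l - 1) ^ n))"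

text \<open>
  Strong (Bochner) measurability is spelled out because Borel measurability is
  too weak when the target space is not separable. Elements of \<open>L\<^sup>p\<close> are represented
  by functions; identification almost everywhere is made explicit where it is used.
\<close>

abbreviation unit_interval_measure :: "real measure" where
  "unit_interval_measure \<equiv> lebesgue_on {0..1}"

definition strongly_measurable :: "'b measure \<Rightarrow> ('b \<Rightarrow> 'a::real_normed_vector) \<Rightarrow> bool" where
  "strongly_measurable M f \<longleftrightarrow>
     (\<exists>s. (\<forall>k::nat. simple_function M (s k)) \<and> (AE t in M. (\<lambda>k. s k t) \<longlonglongrightarrow> f t))"

definition Lp_space :: "real \<Rightarrow> (real \<Rightarrow> 'a::real_normed_vector) set" where
  "Lp_space p = {f. strongly_measurable unit_interval_measure f \<and>
     integrable unit_interval_measure (\<lambda>t. norm (f t) powr p)}"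

definition Lp_norm :: "real \<Rightarrow> (real \<Rightarrow> 'a::real_normed_vector) \<Rightarrow> real" where
  "Lp_norm p f = (LINT t|unit_interval_measure. norm (f t) powr p) powr (1 / p)"

text \<open>
  Linearity and the norm bound together imply that \<open>P\<close> respects equality almost
  everywhere, so \<open>P\<close> induces an operator on the quotient.
\<close>

definition bounded_operator_Lp ::
    "real \<Rightarrow> ((real \<Rightarrow> 'a::complex_banach) \<Rightarrow> (real \<Rightarrow> 'a)) \<Rightarrow> bool" where
  "bounded_operator_Lp p P \<longleftrightarrow>
     (\<forall>f\<in>Lp_space p. P f \<in> Lp_space p) \<and>
     (\<forall>f\<in>Lp_space p. \<forall>g\<in>Lp_space p.
        AE t in unit_interval_measure. P (\<lambda>s. f s + g s) t = P f t + P g t) \<and>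
     (\<forall>c. \<forall>f\<in>Lp_space p.
        AE t in unit_interval_measure. P (\<lambda>s. c *\<^sub>C f s) t = c *\<^sub>C P f t) \<and>
     (\<exists>B. \<forall>f\<in>Lp_space p. Lp_norm p (P f) \<le> B * Lp_norm p f)"

definition trig_poly :: "int set \<Rightarrow> (int \<Rightarrow> 'a::complex_banach) \<Rightarrow> real \<Rightarrow> 'a" where
  "trig_poly S x t = (\<Sum>n\<in>S. cis (2 * pi * of_int n * t) *\<^sub>C x n)"

definition UMD :: "'a::complex_banach itself \<Rightarrow> bool" where
  "UMD _ \<longleftrightarrow> (\<exists>p>1. \<exists>P :: (real \<Rightarrow> 'a) \<Rightarrow> (real \<Rightarrow> 'a). bounded_operator_Lp p P \<and>
     (\<forall>S x. finite S \<longrightarrow>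
        (AE t in unit_interval_measure. P (trig_poly S x) t = trig_poly {n \<in> S. n \<ge> 0} x t)))"

end

theory Submission
  imports Defs
begin

text \<open>
  The first ingredient is an upper estimate for trigonometric polynomials \<open>f\<^sub>1, \<dots>, f\<^sub>N\<close> with
  consecutive frequency intervals. Apply the Hilbert transform in a second variable \<open>s\<close> to
  \<open>\<Sum>\<^sub>j u\<^sub>j(s) f\<^sub>j\<close>, where the \<open>u\<^sub>j \<ge> 0\<close> are translated Fejer kernels spread over half of the circle and
  part of a partition of unity. Cutting the result to frequency blocks that depend on \<open>s\<close> and
  integrating over \<open>s\<close> returns \<open>c \<Sum>\<^sub>j f\<^sub>j\<close> with \<open>c\<close> of order at least \<open>ln N / N\<close>, because the primitive
  of the conjugate kernel is logarithmically large. So for one large \<open>N\<close> the norm of \<open>\<Sum>\<^sub>j f\<^sub>j\<close> is at most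
  \<open>N / 2\<close> times the largest \<open>\<parallel>f\<^sub>j\<parallel>\<close>, and iterating gives \<open>(N / 2)\<^sup>i\<close> for \<open>N\<^sup>i\<close> pieces.

  The second ingredient is strong Kreiss boundedness: \<open>(1 - \<zeta>T)\<^sup>-\<^sup>n\<close> multiplied by a probability weight
  is a sum \<open>\<Sum>\<^sub>k w\<^sub>k z\<^sup>k T\<^sup>k\<close> of norm at most \<open>K\<close>, with negative binomial weights concentrated around
  their mean \<open>r\<close> on the scale \<open>\<surd>r\<close>. Multiplying \<open>\<Sum>\<^bsub>j<W\<^esub> z\<^sup>j T\<^sup>j x\<close> by it shows that the sum over any
  window of length about \<open>\<surd>r\<close> near \<open>r\<close> is controlled by the initial sum of the same length. Hence the
  norm \<open>S(n)\<close> of the initial sum satisfies \<open>S(n) \<le> C (N / 2)\<^sup>i S(N \<surd>n)\<close> for \<open>N\<^sup>i = \<surd>n\<close>, which gives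
  \<open>S(n) \<le> A n\<^sup>\<beta>\<close> with \<open>\<beta> < 1\<close>; finally \<open>\<parallel>T\<^sup>n x\<parallel>\<close> is bounded by a multiple of \<open>S(\<surd>n)\<close>.
\<close>

section \<open>Norms of Banach space valued functions\<close>

interpretation scaleC: bounded_bilinear "scaleC :: complex \<Rightarrow> 'a \<Rightarrow> 'a::complex_banach"
proof
  show "(r *\<^sub>R a) *\<^sub>C b = r *\<^sub>R (a *\<^sub>C b)" for r a and b :: 'a
    by (simp add: scaleR_scaleC scaleC_scaleC scaleR_conv_of_real)
  show "a *\<^sub>C (r *\<^sub>R b) = r *\<^sub>R (a *\<^sub>C b)" for r a and b :: 'a
    by (simp add: scaleR_scaleC scaleC_scaleC mult.commute)
  show "\<exists>K. \<forall>a (b::'a). norm (a *\<^sub>C b) \<le> norm a * norm b * K"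
    by (rule exI[of _ 1]) (simp add: norm_scaleC)
qed (simp_all add: scaleC_add_left scaleC_add_right)

declare scaleC.zero_left [simp] scaleC.zero_right [simp] scaleC_one [simp]

text \<open>Convexity: the graph of the \<open>p\<close>-th power lies above its tangent at
  \<open>a\<close>. For positive \<open>a\<close> and \<open>y\<close> this is Young's inequality
  with weights \<open>1/p\<close> and \<open>1 - 1/p\<close>. Both Jensen estimates below, for sums
  and for integrals, rest on it.\<close>

lemma powr_ge_tangent:
  fixes p a y :: real
  assumes "p > 1" "a \<ge> 0" "y \<ge> 0"
  shows "a powr p + p * a powr (p - 1) * (y - a) \<le> y powr p"
proof (cases "a = 0 \<or> y = 0")
  case True
  then show ?thesis
  proof
    assume "a = 0" then show ?thesis using assms by simp
  next
    assume y: "y = 0"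
    show ?thesis
    proof (cases "a = 0")
      case False
      then have "a powr p = a powr (p - 1) * a"
        using assms by (metis diff_add_cancel powr_add powr_one_gt_zero_iff less_eq_real_def powr_one)
      then have "a powr p + p * a powr (p - 1) * (y - a) = (1 - p) * a powr p"
        using y by (simp add: algebra_simps)
      then show ?thesis using assms y by (simp add: mult_nonpos_nonneg)
    qed (use assms in simp)
  qed
next
  case False
  then have pos: "a > 0" "y > 0" using assms by auto
  have "(y powr p) powr (1/p) * (a powr p) powr (1 - 1/p) \<le> (1/p) * y powr p + (1 - 1/p) * a powr p"
    using assms pos by (intro Youngs_inequality_0) auto
  moreover have "(y powr p) powr (1/p) = y" "(a powr p) powr (1 - 1/p) = a powr (p - 1)"
    using assms pos by (auto simp: powr_powr right_diff_distrib)
  moreover have "a powr p = a powr (p - 1) * a"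
    using pos by (metis diff_add_cancel powr_add powr_one less_eq_real_def)
  ultimately show ?thesis using assms by (simp add: field_simps)
qed

text \<open>Jensen's inequality: take the tangent at the mean \<open>a\<close>; its linear part
  cancels on averaging.\<close>

lemma powr_sum_le:
  fixes v y :: "'i \<Rightarrow> real"
  assumes "p > 1" "finite A" "\<And>l. l \<in> A \<Longrightarrow> v l \<ge> 0" "\<And>l. l \<in> A \<Longrightarrow> y l \<ge> 0" "(\<Sum>l\<in>A. v l) = 1"
  shows "(\<Sum>l\<in>A. v l * y l) powr p \<le> (\<Sum>l\<in>A. v l * y l powr p)"
proof -
  define a where "a = (\<Sum>l\<in>A. v l * y l)"
  have a: "a \<ge> 0" unfolding a_def using assms by (intro sum_nonneg) auto
  have "(\<Sum>l\<in>A. v l * (a powr p + p * a powr (p - 1) * (y l - a))) \<le> (\<Sum>l\<in>A. v l * y l powr p)"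
    using assms a by (intro sum_mono mult_left_mono powr_ge_tangent) auto
  also have "(\<Sum>l\<in>A. v l * (a powr p + p * a powr (p - 1) * (y l - a)))
     = (\<Sum>l\<in>A. (a powr p - p * a powr (p - 1) * a) * v l + (p * a powr (p - 1)) * (v l * y l))"
    by (intro sum.cong) (auto simp: algebra_simps)
  also have "\<dots> = a powr p"
    by (simp only: sum.distrib sum_distrib_left[symmetric] assms(5) a_def[symmetric]) simp
  finally show ?thesis by (simp add: a_def)
qed

section \<open>Lp norms of continuous functions as gauge integrals\<close>

lemma integrable_lebesgue_on_unit_interval:
  fixes f :: "real \<Rightarrow> real"
  assumes "continuous_on {0..1} f"
  shows "integrable (lebesgue_on {0..1}) f"
  using assms by (intro integrable_continuous_real continuous_imp_integrable_real) auto

lemma continuous_on_norm_powr [continuous_intros]: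
  fixes f :: "'b::topological_space \<Rightarrow> 'a::real_normed_vector"
  assumes "continuous_on S f" "p > 0"
  shows "continuous_on S (\<lambda>t. norm (f t) powr p)"
  using assms by (intro continuous_on_powr' continuous_on_norm continuous_on_const) auto

lemma Lp_norm_eq_integral:
  fixes f :: "real \<Rightarrow> 'a::real_normed_vector"
  assumes "continuous_on {0..1} f" "p > 0"
  shows "Lp_norm p f = (integral {0..1} (\<lambda>t. norm (f t) powr p)) powr (1 / p)"
  unfolding Lp_norm_def using assms
  by (subst lebesgue_integral_eq_integral)
     (auto intro!: integrable_lebesgue_on_unit_interval continuous_intros)

lemma integral_norm_powr_nonneg: "0 \<le> integral S (\<lambda>t. norm (f t) powr p)"
  by (cases "(\<lambda>t. norm (f t) powr p) integrable_on S")
     (auto intro: integral_nonneg simp: not_integrable_integral)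

lemma Lp_norm_nonneg: "0 \<le> Lp_norm p f"
  by (simp add: Lp_norm_def)

lemma Lp_norm_powr:
  assumes "continuous_on {0..1} f" "p > 0"
  shows "Lp_norm p f powr p = integral {0..1} (\<lambda>t. norm (f t) powr p)"
  using assms integral_norm_powr_nonneg[of "{0..1}" f p]
  by (simp add: Lp_norm_eq_integral powr_powr)

lemma Lp_norm_le_iff:
  assumes "continuous_on {0..1} f" "p > 0" "M \<ge> 0"
  shows "Lp_norm p f \<le> M \<longleftrightarrow> integral {0..1} (\<lambda>t. norm (f t) powr p) \<le> M powr p"
  using assms Lp_norm_nonneg[of p f] powr_mono2[of p "Lp_norm p f" M] powr_less_mono2[of p M "Lp_norm p f"]
  by (force simp flip: Lp_norm_powr)

lemma Lp_norm_mono: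
  fixes f :: "real \<Rightarrow> 'a::real_normed_vector" and g :: "real \<Rightarrow> 'b::real_normed_vector"
  assumes "continuous_on {0..1} f" "continuous_on {0..1} g" "p > 0" "c \<ge> 0"
    and "\<And>t. 0 \<le> t \<Longrightarrow> t \<le> 1 \<Longrightarrow> norm (f t) \<le> c * norm (g t)"
  shows "Lp_norm p f \<le> c * Lp_norm p g"
proof -
  have "integral {0..1} (\<lambda>t. norm (f t) powr p) \<le> integral {0..1} (\<lambda>t. c powr p * norm (g t) powr p)"
  proof (rule integral_le)
    fix t :: real assume "t \<in> {0..1}"
    then have "norm (f t) powr p \<le> (c * norm (g t)) powr p"
      using assms by (intro powr_mono2) auto
    then show "norm (f t) powr p \<le> c powr p * norm (g t) powr p"
      using assms by (simp add: powr_mult)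
  qed (use assms in \<open>auto intro!: integrable_continuous_real continuous_intros\<close>)
  also have "\<dots> = (c * Lp_norm p g) powr p"
    using assms by (simp add: powr_mult Lp_norm_powr Lp_norm_nonneg)
  finally show ?thesis
    using assms Lp_norm_nonneg[of p g] by (subst Lp_norm_le_iff) auto
qed

lemma Lp_norm_cong:
  assumes "\<And>t. 0 \<le> t \<Longrightarrow> t \<le> 1 \<Longrightarrow> norm (f t) = norm (g t)"
  shows "Lp_norm p f = Lp_norm p g"
  unfolding Lp_norm_def by (rule arg_cong[of _ _ "\<lambda>x. x powr (1 / p)"], rule Bochner_Integration.integral_cong)
    (use assms in auto)

lemma Lp_norm_const: "p > 0 \<Longrightarrow> Lp_norm p (\<lambda>_. v) = norm v"
  by (subst Lp_norm_eq_integral) (auto simp: powr_powr)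

text \<open>A version of Minkowski's inequality with one common bound \<open>M\<close>. It follows
  pointwise from Jensen's inequality with the weights \<open>cmod (w l) / W\<close> and then by
  integration.\<close>

lemma Lp_norm_sum_le:
  fixes g :: "'i \<Rightarrow> real \<Rightarrow> 'a::complex_banach"
  assumes p: "p > 1" and A: "finite A" and M: "M \<ge> 0"
    and g: "\<And>l. l \<in> A \<Longrightarrow> continuous_on {0..1} (g l)" "\<And>l. l \<in> A \<Longrightarrow> Lp_norm p (g l) \<le> M"
  shows "Lp_norm p (\<lambda>t. \<Sum>l\<in>A. w l *\<^sub>C g l t) \<le> (\<Sum>l\<in>A. cmod (w l)) * M"
proof -
  define W where "W = (\<Sum>l\<in>A. cmod (w l))"
  have W0: "W \<ge> 0" by (auto simp: W_def intro: sum_nonneg)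
  have cont: "continuous_on {0..1} (\<lambda>t. \<Sum>l\<in>A. w l *\<^sub>C g l t)"
    using g by (intro continuous_intros scaleC.continuous_on) auto
  have "integral {0..1} (\<lambda>t. norm (\<Sum>l\<in>A. w l *\<^sub>C g l t) powr p) \<le> (W * M) powr p"
  proof (cases "W = 0")
    case True
    then have "w l = 0" if "l \<in> A" for l
      using that A by (simp add: W_def sum_nonneg_eq_0_iff)
    then have "(\<Sum>l\<in>A. w l *\<^sub>C g l t) = 0" for t by (intro sum.neutral) auto
    then show ?thesis by simp
  next
    case False
    then have W: "W > 0" using W0 by simp
    have v1: "(\<Sum>l\<in>A. cmod (w l) / W) = 1"
      using W by (simp flip: sum_divide_distrib W_def)
    have "integral {0..1} (\<lambda>t. norm (\<Sum>l\<in>A. w l *\<^sub>C g l t) powr p)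
      \<le> integral {0..1} (\<lambda>t. W powr p * (\<Sum>l\<in>A. cmod (w l) / W * norm (g l t) powr p))"
    proof (rule integral_le)
      fix t :: real assume t: "t \<in> {0..1}"
      have "norm (\<Sum>l\<in>A. w l *\<^sub>C g l t) \<le> (\<Sum>l\<in>A. cmod (w l) * norm (g l t))"
        by (intro sum_norm_le) (simp add: norm_scaleC)
      also have "\<dots> = W * (\<Sum>l\<in>A. cmod (w l) / W * norm (g l t))"
        using W by (simp add: sum_distrib_left)
      finally have "norm (\<Sum>l\<in>A. w l *\<^sub>C g l t) powr p
          \<le> W powr p * (\<Sum>l\<in>A. cmod (w l) / W * norm (g l t)) powr p"
        using W p by (subst powr_mult[symmetric]) (auto intro!: powr_mono2 sum_nonneg)
      also have "\<dots> \<le> W powr p * (\<Sum>l\<in>A. cmod (w l) / W * norm (g l t) powr p)"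
        using W p A v1 by (intro mult_left_mono powr_sum_le) auto
      finally show "norm (\<Sum>l\<in>A. w l *\<^sub>C g l t) powr p
          \<le> W powr p * (\<Sum>l\<in>A. cmod (w l) / W * norm (g l t) powr p)" .
    qed (use g p cont W in \<open>auto intro!: integrable_continuous_real continuous_intros\<close>)
    also have "\<dots> = W powr p * (\<Sum>l\<in>A. cmod (w l) / W * Lp_norm p (g l) powr p)"
      using g p A by (simp add: Lp_norm_powr integral_sum integrable_continuous_real continuous_intros del: times_divide_eq_left)
    also have "\<dots> \<le> W powr p * (\<Sum>l\<in>A. cmod (w l) / W * M powr p)"
      using g p W by (intro mult_left_mono sum_mono powr_mono2) (auto simp: Lp_norm_nonneg)
    also have "\<dots> = (W * M) powr p"
      unfolding sum_distrib_right[symmetric] v1 using W M by (simp add: powr_mult)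
    finally show ?thesis .
  qed
  then show ?thesis
    using p M W0 cont by (subst Lp_norm_le_iff) (auto simp: W_def)
qed

lemma Lp_norm_diff_le:
  fixes f g :: "real \<Rightarrow> 'a::complex_banach"
  assumes "p > 1" "continuous_on {0..1} f" "continuous_on {0..1} g" "Lp_norm p f \<le> M" "Lp_norm p g \<le> M"
  shows "Lp_norm p (\<lambda>t. f t - g t) \<le> 2 * M"
proof -
  have M: "M \<ge> 0" using assms Lp_norm_nonneg order_trans by blast
  have eq: "f t - g t = (\<Sum>b\<in>UNIV. (if b then 1 else - 1) *\<^sub>C (if b then f t else g t))" for t
    by (simp add: UNIV_bool scaleC_one scaleC.minus_left)
  have "Lp_norm p (\<lambda>t. \<Sum>b\<in>UNIV. (if b then 1 else - 1) *\<^sub>C (if b then f t else g t))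
     \<le> (\<Sum>b\<in>UNIV. cmod (if b then 1 else - 1)) * M"
  proof (rule Lp_norm_sum_le)
    fix b show "continuous_on {0..1} (\<lambda>t. if b then f t else g t)"
      "Lp_norm p (\<lambda>t. if b then f t else g t) \<le> M"
      by (cases b; use assms in simp)+
  qed (use assms M in auto)
  then show ?thesis unfolding eq by (simp add: UNIV_bool)
qed

lemma continuous_on_trig_poly [continuous_intros]: "continuous_on A (trig_poly S x)"
  unfolding trig_poly_def by (intro continuous_intros scaleC.continuous_on)

text \<open>Sampling \<open>f\<close> at the multiples of \<open>1 / Suc k\<close> below
  \<open>t\<close> gives functions with finitely many values, which converge everywhere on the
  interval by continuity. This makes trigonometric polynomials Bochner measurable, as
  \<open>Lp_space\<close> demands.\<close>

lemma strongly_measurable_continuous: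
  fixes f :: "real \<Rightarrow> 'a::real_normed_vector"
  assumes "continuous_on {0..1} f"
  shows "strongly_measurable (lebesgue_on {0..1}) f"
proof -
  define s where "s k t = f (of_int \<lfloor>real (Suc k) * t\<rfloor> / real (Suc k))" for k :: nat and t :: real
  have "simple_function (lebesgue_on {0..1}) (s k)" for k
  proof -
    have "simple_function (lebesgue_on {0..1}) (\<lambda>t::real. \<lfloor>real (Suc k) * t\<rfloor>)"
      unfolding simple_function_def
    proof (intro conjI ballI)
      have "(\<lambda>t::real. \<lfloor>real (Suc k) * t\<rfloor>) ` {0..1} \<subseteq> {0..int (Suc k)}"
      proof clarsimp
        fix t :: real assume t: "0 \<le> t" "t \<le> 1"
        have "(1 + real k) * t \<le> 1 + real k" using t by (simp add: mult_left_le)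
        then show "\<lfloor>(1 + real k) * t\<rfloor> \<le> 1 + int k" by linarith
      qed
      then show "finite ((\<lambda>t::real. \<lfloor>real (Suc k) * t\<rfloor>) ` space (lebesgue_on {0..1}))"
        using finite_subset by (simp add: space_restrict_space) blast
      fix i assume "i \<in> (\<lambda>t::real. \<lfloor>real (Suc k) * t\<rfloor>) ` space (lebesgue_on {0..1})"
      have "(\<lambda>t::real. \<lfloor>real (Suc k) * t\<rfloor>) -` {i} \<inter> space (lebesgue_on {0..1})
        = {of_int i / real (Suc k) ..< (of_int i + 1) / real (Suc k)} \<inter> {0..1}"
        unfolding vimage_def floor_eq_iff
        by (auto simp: space_restrict_space pos_le_divide_eq pos_divide_le_eq pos_less_divide_eq mult.commute intro!: floor_unique)
      then show "(\<lambda>t::real. \<lfloor>real (Suc k) * t\<rfloor>) -` {i} \<inter> space (lebesgue_on {0..1}) \<in> sets (lebesgue_on {0..1})"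
        by (simp add: sets_restrict_space_iff)
    qed
    from simple_function_compose[OF this, of "\<lambda>i. f (of_int i / real (Suc k))"]
    show ?thesis by (simp add: s_def[abs_def] o_def)
  qed
  moreover have "(\<lambda>k. s k t) \<longlonglongrightarrow> f t" if t: "t \<in> {0..1}" for t
  proof -
    have lim: "(\<lambda>k. of_int \<lfloor>real (Suc k) * t\<rfloor> / real (Suc k)) \<longlonglongrightarrow> t"
    proof (rule tendsto_sandwich)
      show "(\<lambda>k. t - 1 / real (Suc k)) \<longlonglongrightarrow> t"
        using tendsto_diff[OF tendsto_const LIMSEQ_inverse_real_of_nat, of t] by (simp add: field_simps)
      show "\<forall>\<^sub>F k in sequentially. t - 1 / real (Suc k) \<le> of_int \<lfloor>real (Suc k) * t\<rfloor> / real (Suc k)"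
      proof (intro always_eventually allI)
        fix k
        have "real (Suc k) * t - 1 \<le> of_int \<lfloor>real (Suc k) * t\<rfloor>" by linarith
        then have "(real (Suc k) * t - 1) / real (Suc k) \<le> of_int \<lfloor>real (Suc k) * t\<rfloor> / real (Suc k)"
          by (rule divide_right_mono) simp
        then show "t - 1 / real (Suc k) \<le> of_int \<lfloor>real (Suc k) * t\<rfloor> / real (Suc k)"
          by (simp add: diff_divide_distrib del: of_nat_Suc)
      qed
      show "\<forall>\<^sub>F k in sequentially. of_int \<lfloor>real (Suc k) * t\<rfloor> / real (Suc k) \<le> t"
      proof (intro always_eventually allI)
        fix k
        have "of_int \<lfloor>real (Suc k) * t\<rfloor> \<le> real (Suc k) * t" by linarith
        then show "of_int \<lfloor>real (Suc k) * t\<rfloor> / real (Suc k) \<le> t"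
          by (simp add: field_simps)
      qed
    qed simp
    have inI: "of_int \<lfloor>real (Suc k) * t\<rfloor> / real (Suc k) \<in> {0..1}" for k
    proof -
      have "real (Suc k) * t \<le> real (Suc k)" using t by (simp add: mult_left_le)
      then have "of_int \<lfloor>real (Suc k) * t\<rfloor> \<le> real (Suc k)" by linarith
      moreover have "0 \<le> \<lfloor>real (Suc k) * t\<rfloor>" using t by simp
      ultimately show ?thesis by (simp add: divide_le_eq_1)
    qed
    show ?thesis unfolding s_def
      using assms t inI by (intro continuous_on_tendsto_compose[OF assms lim]) auto
  qed
  ultimately show ?thesis
    unfolding strongly_measurable_def by (intro exI[of _ s] conjI allI AE_I2) (auto simp: space_restrict_space)
qed

lemma continuous_in_Lp_space:
  fixes f :: "real \<Rightarrow> 'a::real_normed_vector"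
  assumes "continuous_on {0..1} f" "p > 0"
  shows "f \<in> Lp_space p"
  unfolding Lp_space_def
  using assms by (auto intro!: strongly_measurable_continuous integrable_lebesgue_on_unit_interval continuous_intros)

section \<open>Frequency cuts\<close>

text \<open>The form in which the UMD property is used from here on: a norm inequality for
  trigonometric polynomials alone, without the operator \<open>P\<close>. Normalising
  \<open>B \<ge> 1\<close> lets powers of \<open>B\<close> be compared.\<close>

locale riesz_bounded =
  fixes p B :: real and ty :: "'a::complex_banach itself"
  assumes p_gt_1: "p > 1" and B_ge_1: "B \<ge> 1"
    and riesz: "\<And>S (x :: int \<Rightarrow> 'a). finite S \<Longrightarrow>
      Lp_norm p (trig_poly {n \<in> S. n \<ge> 0} x) \<le> B * Lp_norm p (trig_poly S x)"

text \<open>Trigonometric polynomials are continuous, hence in \<open>Lp_space p\<close>, and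
  \<open>P\<close> cuts them up to a null set, which the norm does not see.\<close>

lemma UMD_imp_riesz_bounded:
  assumes "UMD TYPE('a::complex_banach)"
  obtains p B where "riesz_bounded TYPE('a) p B"
proof -
  from assms obtain p and P :: "(real \<Rightarrow> 'a) \<Rightarrow> (real \<Rightarrow> 'a)" where p: "p > 1"
    and P: "bounded_operator_Lp p P"
    and AE: "\<And>S x. finite S \<Longrightarrow>
      AE t in unit_interval_measure. P (trig_poly S x) t = trig_poly {n \<in> S. n \<ge> 0} x t"
    unfolding UMD_def by blast
  from P obtain B where B: "\<And>f. f \<in> Lp_space p \<Longrightarrow> Lp_norm p (P f) \<le> B * Lp_norm p f"
    and PL: "\<And>f. f \<in> Lp_space p \<Longrightarrow> P f \<in> Lp_space p"
    unfolding bounded_operator_Lp_def by blast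
  have "riesz_bounded TYPE('a) p (max 1 B)"
  proof
    fix S :: "int set" and x :: "int \<Rightarrow> 'a" assume S: "finite S"
    have in_Lp: "trig_poly A x \<in> Lp_space p" for A
      using p by (intro continuous_in_Lp_space continuous_intros) auto
    have "Lp_norm p (trig_poly {n \<in> S. n \<ge> 0} x) = Lp_norm p (P (trig_poly S x))"
      unfolding Lp_norm_def
    proof (rule arg_cong[of _ _ "\<lambda>x. x powr (1 / p)"], rule integral_cong_AE)
      show "(\<lambda>t. norm (P (trig_poly S x) t) powr p) \<in> borel_measurable unit_interval_measure"
        "(\<lambda>t. norm (trig_poly {n \<in> S. n \<ge> 0} x t) powr p) \<in> borel_measurable unit_interval_measure"
        using PL[OF in_Lp] in_Lp by (auto simp: Lp_space_def)
      show "AE t in unit_interval_measure. norm (trig_poly {n \<in> S. 0 \<le> n} x t) powr p =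
          norm (P (trig_poly S x) t) powr p"
        using AE[OF S, of x] by eventually_elim simp
    qed
    also have "\<dots> \<le> B * Lp_norm p (trig_poly S x)" by (rule B[OF in_Lp])
    also have "\<dots> \<le> max 1 B * Lp_norm p (trig_poly S x)"
      by (intro mult_right_mono Lp_norm_nonneg) simp
    finally show "Lp_norm p (trig_poly {n \<in> S. n \<ge> 0} x) \<le> max 1 B * Lp_norm p (trig_poly S x)" .
  qed (use p in auto)
  then show ?thesis by (rule that)
qed

lemma trig_poly_translate:
  "trig_poly ((\<lambda>n. n + m) ` S) x t = cis (2 * pi * of_int m * t) *\<^sub>C trig_poly S (\<lambda>n. x (n + m)) t"
proof -
  have "trig_poly ((\<lambda>n. n + m) ` S) x t = (\<Sum>n\<in>S. cis (2 * pi * of_int (n + m) * t) *\<^sub>C x (n + m))"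
    unfolding trig_poly_def by (subst sum.reindex) (auto simp: inj_on_def)
  also have "\<dots> = cis (2 * pi * of_int m * t) *\<^sub>C trig_poly S (\<lambda>n. x (n + m)) t"
    unfolding trig_poly_def scaleC.sum_right
    by (intro sum.cong) (simp_all add: scaleC_scaleC cis_mult ring_distribs add.commute)
  finally show ?thesis .
qed

lemma trig_poly_Un:
  assumes "finite S" "finite S'" "S \<inter> S' = {}"
  shows "trig_poly (S \<union> S') x t = trig_poly S x t + trig_poly S' x t"
  using assms unfolding trig_poly_def by (rule sum.union_disjoint)

context riesz_bounded
begin

lemma p_pos: "p > 0" and B_pos: "B > 0"
  using p_gt_1 B_ge_1 by auto

text \<open>Multiplication by a character shifts all frequencies and keeps the pointwise norm, so
  the cut at 0 can be moved to any \<open>m\<close> at the same cost.\<close>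

lemma Lp_norm_trig_poly_ge:
  fixes x :: "int \<Rightarrow> 'a"
  assumes "finite S"
  shows "Lp_norm p (trig_poly {n \<in> S. m \<le> n} x) \<le> B * Lp_norm p (trig_poly S x)"
proof -
  define S' where "S' = (\<lambda>n. n - m) ` S"
  have S: "S = (\<lambda>n. n + m) ` S'" by (simp add: S'_def image_image)
  have "{n \<in> S'. 0 \<le> n} = (\<lambda>n. n - m) ` {n \<in> S. m \<le> n}" by (auto simp: S'_def)
  then have S2: "{n \<in> S. m \<le> n} = (\<lambda>n. n + m) ` {n \<in> S'. 0 \<le> n}" by (simp add: image_image)
  have "Lp_norm p (trig_poly {n \<in> S'. 0 \<le> n} (\<lambda>n. x (n + m))) \<le> B * Lp_norm p (trig_poly S' (\<lambda>n. x (n + m)))"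
    using assms by (intro riesz) (auto simp: S'_def)
  moreover have "Lp_norm p (trig_poly ((\<lambda>n. n + m) ` U) x) = Lp_norm p (trig_poly U (\<lambda>n. x (n + m)))" for U
    by (rule Lp_norm_cong) (simp add: trig_poly_translate norm_scaleC)
  ultimately show ?thesis unfolding S2 by (simp add: S)
qed

text \<open>A frequency block is the difference of two half-line cuts, the second one applied to the
  result of the first; this accounts for the constant.\<close>

lemma Lp_norm_trig_poly_interval:
  fixes x :: "int \<Rightarrow> 'a"
  assumes S: "finite S" and sub: "{a..<b} \<subseteq> S"
  shows "Lp_norm p (trig_poly {a..<b} x) \<le> 2 * B\<^sup>2 * Lp_norm p (trig_poly S x)"
proof (cases "a \<le> b")
  case True
  let ?N = "Lp_norm p (trig_poly S x)" and ?S = "{n \<in> S. a \<le> n}"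
  have "{a..<b} \<union> {n \<in> ?S. b \<le> n} = ?S" "{a..<b} \<inter> {n \<in> ?S. b \<le> n} = {}"
    using True sub by auto
  with trig_poly_Un[of "{a..<b}" "{n \<in> ?S. b \<le> n}" x] S
  have eq: "trig_poly {a..<b} x t = trig_poly ?S x t - trig_poly {n \<in> ?S. b \<le> n} x t" for t
    by simp
  have 1: "Lp_norm p (trig_poly ?S x) \<le> B * ?N"
    using S by (rule Lp_norm_trig_poly_ge)
  have "Lp_norm p (trig_poly {n \<in> ?S. b \<le> n} x) \<le> B * Lp_norm p (trig_poly ?S x)"
    using S by (intro Lp_norm_trig_poly_ge) auto
  also have "\<dots> \<le> B * (B * ?N)" using 1 B_pos by (intro mult_left_mono) auto
  finally have 2: "Lp_norm p (trig_poly {n \<in> ?S. b \<le> n} x) \<le> B\<^sup>2 * ?N"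
    by (simp add: power2_eq_square)
  have "B * ?N \<le> B\<^sup>2 * ?N"
    using B_ge_1 by (intro mult_right_mono Lp_norm_nonneg) (simp add: power2_eq_square)
  with 1 have "Lp_norm p (trig_poly ?S x) \<le> B\<^sup>2 * ?N" by simp
  from Lp_norm_diff_le[OF p_gt_1 _ _ this 2] show ?thesis
    by (simp add: eq[abs_def] continuous_intros)
next
  case False
  then have "trig_poly {a..<b} x = (\<lambda>t. 0)" by (simp add: trig_poly_def[abs_def])
  then show ?thesis using Lp_norm_const[OF p_pos, of "0::'a"] B_pos Lp_norm_nonneg[of p "trig_poly S x"] by simp
qed

text \<open>Boundedness of the Hilbert transform. Its multiplier is \<open>- \<i>\<close> times the
  sum of the indicators of \<open>n \<ge> 0\<close> and \<open>n \<ge> 1\<close> minus 1, a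
  combination of three operators of norm at most \<open>B\<close>.\<close>

lemma Lp_norm_trig_poly_conjugate:
  fixes x :: "int \<Rightarrow> 'a"
  assumes S: "finite S"
  shows "Lp_norm p (trig_poly S (\<lambda>n. (- \<i> * of_int (sgn n)) *\<^sub>C x n)) \<le> 3 * B * Lp_norm p (trig_poly S x)"
proof -
  \<comment> \<open>The indices 0 and 1 stand for the cuts at 0 and 1, the index 2 for the uncut
    polynomial.\<close>
  define g :: "nat \<Rightarrow> real \<Rightarrow> 'a" where "g l = trig_poly {n \<in> S. l = 2 \<or> int l \<le> n} x" for l
  define w where "w l = (if l = 2 then \<i> else - \<i>)" for l :: nat
  have "trig_poly S (\<lambda>n. (- \<i> * of_int (sgn n)) *\<^sub>C x n) t = (\<Sum>l<3. w l *\<^sub>C g l t)" for t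
  proof -
    have "(\<Sum>l<3. w l *\<^sub>C g l t) = (\<Sum>l<3. \<Sum>n\<in>S. if l = 2 \<or> int l \<le> n
        then w l *\<^sub>C cis (2 * pi * of_int n * t) *\<^sub>C x n else 0)"
      using S unfolding g_def trig_poly_def scaleC.sum_right
      by (intro sum.cong[OF refl] sum.inter_filter)
    also have "\<dots> = (\<Sum>n\<in>S. \<Sum>l<3. if l = 2 \<or> int l \<le> n
        then w l *\<^sub>C cis (2 * pi * of_int n * t) *\<^sub>C x n else 0)"
      by (rule sum.swap)
    also have "\<dots> = (\<Sum>n\<in>S. cis (2 * pi * of_int n * t) *\<^sub>C (- \<i> * of_int (sgn n)) *\<^sub>C x n)"
    proof (rule sum.cong[OF refl])
      fix n assume "n \<in> S"
      consider "n < 0" | "n = 0" | "n > 0" by linarith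
      then show "(\<Sum>l<3. if l = 2 \<or> int l \<le> n then w l *\<^sub>C cis (2 * pi * of_int n * t) *\<^sub>C x n else 0)
        = cis (2 * pi * of_int n * t) *\<^sub>C (- \<i> * of_int (sgn n)) *\<^sub>C x n"
        by cases (simp_all add: eval_nat_numeral w_def scaleC_scaleC scaleC.minus_left scaleC.minus_right mult.commute)
    qed
    finally show ?thesis by (simp add: trig_poly_def)
  qed
  moreover have "Lp_norm p (\<lambda>t. \<Sum>l<3. w l *\<^sub>C g l t) \<le> (\<Sum>l<3. cmod (w l)) * (B * Lp_norm p (trig_poly S x))"
  proof (rule Lp_norm_sum_le)
    fix l :: nat
    show "Lp_norm p (g l) \<le> B * Lp_norm p (trig_poly S x)"
    proof (cases "l = 2")
      case True
      then show ?thesis using mult_right_mono[OF B_ge_1 Lp_norm_nonneg] by (simp add: g_def)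
    next
      case False
      then show ?thesis using Lp_norm_trig_poly_ge[OF S] by (simp add: g_def)
    qed
  qed (use p_gt_1 B_pos in \<open>auto simp: g_def Lp_norm_nonneg intro!: continuous_intros\<close>)
  moreover have "(\<Sum>l<3. cmod (w l)) = 3" by (simp add: w_def eval_nat_numeral)
  ultimately show ?thesis by (metis (no_types, lifting) ext mult.assoc)
qed

end

section \<open>The Fejer kernel and its conjugate\<close>

text \<open>The Fejer kernel divided by \<open>L\<close>: with this normalisation the
  \<open>L\<close> equally spaced translates, rather than the integral, add up to 1.\<close>

definition fejer :: "nat \<Rightarrow> real \<Rightarrow> real" where
  "fejer L s = (real L + 2 * (\<Sum>k=1..<L. (real L - real k) * cos (real k * (2 * pi * s)))) / (real L)\<^sup>2"

text \<open>The Hilbert transform of \<open>fejer L\<close>: each cosine is replaced by the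
  corresponding sine.\<close>

definition conj_fejer :: "nat \<Rightarrow> real \<Rightarrow> real" where
  "conj_fejer L s = 2 * (\<Sum>k=1..<L. (real L - real k) * sin (real k * (2 * pi * s))) / (real L)\<^sup>2"

definition conj_fejer_primitive :: "nat \<Rightarrow> real \<Rightarrow> real" where
  "conj_fejer_primitive L s = - (\<Sum>k=1..<L. (real L - real k) * cos (real k * (2 * pi * s)) / (pi * real k)) / (real L)\<^sup>2"

text \<open>The purpose is nonnegativity of the kernel. In the induction the new summand
  \<open>cis (real L * \<theta>)\<close> contributes 1 and twice the real part of a cross term,
  which is the sum of the cosines of frequency 1 to \<open>L\<close>.\<close>

lemma fejer_sum_eq_norm_squared:
  "real L + 2 * (\<Sum>k=1..<L. (real L - real k) * cos (real k * \<theta>)) = (cmod (\<Sum>m<L. cis (real m * \<theta>)))\<^sup>2"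
proof (induction L)
  case (Suc L)
  let ?E = "\<Sum>m<L. cis (real m * \<theta>)"
  have "Re (?E * cnj (cis (real L * \<theta>))) = (\<Sum>m<L. cos ((real L - real m) * \<theta>))"
    unfolding sum_distrib_right Re_sum
    by (intro sum.cong refl) (simp add: cis_cnj cis_mult left_diff_distrib cos_diff)
  also have "\<dots> = (\<Sum>m<L. cos (real (Suc (L - Suc m)) * \<theta>))"
    by (intro sum.cong refl arg_cong[of _ _ cos] arg_cong2[of _ _ _ _ times]) auto
  also have "\<dots> = (\<Sum>m<L. cos (real (Suc m) * \<theta>))"
    by (rule sum.nat_diff_reindex)
  also have "\<dots> = (\<Sum>k=1..<Suc L. cos (real k * \<theta>))"
    unfolding atLeastLessThanSuc_atLeastAtMost by (simp only: sum.atLeast1_atMost_eq One_nat_def)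
  finally have Re: "Re (?E * cnj (cis (real L * \<theta>))) = (\<Sum>k=1..<Suc L. cos (real k * \<theta>))" .
  have "real (Suc L) + 2 * (\<Sum>k=1..<Suc L. (real (Suc L) - real k) * cos (real k * \<theta>))
    = (real L + 2 * (\<Sum>k=1..<Suc L. (real L - real k) * cos (real k * \<theta>)))
      + 1 + 2 * (\<Sum>k=1..<Suc L. cos (real k * \<theta>))"
  proof -
    have "(\<Sum>k=1..<Suc L. (real (Suc L) - real k) * cos (real k * \<theta>))
      = (\<Sum>k=1..<Suc L. (real L - real k) * cos (real k * \<theta>) + cos (real k * \<theta>))"
      by (intro sum.cong refl) (simp add: left_diff_distrib distrib_right)
    then show ?thesis unfolding sum.distrib by simp
  qed
  also have "(\<Sum>k=1..<Suc L. (real L - real k) * cos (real k * \<theta>)) = (\<Sum>k=1..<L. (real L - real k) * cos (real k * \<theta>))"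
    by (cases "L = 0") auto
  also have "(real L + 2 * (\<Sum>k=1..<L. (real L - real k) * cos (real k * \<theta>)))
      + 1 + 2 * (\<Sum>k=1..<Suc L. cos (real k * \<theta>)) = (cmod (?E + cis (real L * \<theta>)))\<^sup>2"
  proof -
    have "(cmod (a + cis b))\<^sup>2 = (cmod a)\<^sup>2 + 1 + 2 * Re (a * cnj (cis b))" for a b
    proof -
      have "(x + c)\<^sup>2 + (y + d)\<^sup>2 = x\<^sup>2 + y\<^sup>2 + (d\<^sup>2 + c\<^sup>2) + 2 * (x * c + y * d)" for x y c d :: real
        by (simp add: power2_eq_square algebra_simps)
      from this[of "Re a" "cos b" "Im a" "sin b"] show ?thesis by (simp add: cmod_power2)
    qed
    then show ?thesis unfolding Suc.IH Re[symmetric] by simp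
  qed
  finally show ?case by simp
qed simp

lemma fejer_nonneg: "fejer L s \<ge> 0"
  unfolding fejer_def fejer_sum_eq_norm_squared by simp

text \<open>Real part of a full geometric sum over powers of an \<open>L\<close>-th root of unity,
  which differs from 1 because \<open>L\<close> does not divide \<open>k\<close>.\<close>

lemma sum_cos_translates_eq_0:
  assumes k: "0 < k" "k < L"
  shows "(\<Sum>j<L. cos (real k * (2 * pi * (s - real j / real L)))) = 0"
proof -
  define z where "z = cis (- (2 * pi * real k / real L))"
  have "z \<noteq> 1"
  proof
    assume "z = 1"
    then have "cos (2 * pi * real k / real L) = 1" by (simp add: z_def complex_eq_iff)
    then obtain n :: int where "2 * pi * real k / real L = of_int n * 2 * pi"
      using cos_one_2pi_int by blast
    then have "real k = of_int n * real L" using k by (simp add: field_simps)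
    then have "int k = n * int L" by (metis of_int_eq_iff of_int_mult of_int_of_nat_eq)
    then have "int L dvd int k" by simp
    with k show False by (auto dest: nat_dvd_not_less)
  qed
  moreover have "z ^ L = 1"
  proof -
    have "z ^ L = cis (- (2 * real k * pi))" 
    proof -
      have "real L * - (2 * pi * real k / real L) = - (2 * real k * pi)" using k by simp
      then show ?thesis by (simp only: z_def Complex.DeMoivre)
    qed
    then show ?thesis by (simp add: complex_eq_iff del: cis_cnj)
  qed
  ultimately have "(\<Sum>j<L. z ^ j) = 0" by (simp add: geometric_sum)
  moreover have "(\<Sum>j<L. cis (real k * (2 * pi * (s - real j / real L)))) = cis (real k * (2 * pi * s)) * (\<Sum>j<L. z ^ j)"
    unfolding sum_distrib_left z_def Complex.DeMoivre cis_mult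
    by (intro sum.cong refl arg_cong[of _ _ cis]) (simp add: field_simps)
  ultimately have "Re (\<Sum>j<L. cis (real k * (2 * pi * (s - real j / real L)))) = 0" by simp
  then show ?thesis by simp
qed

text \<open>Partition of unity: summing over the translates kills every frequency except 0.\<close>

lemma sum_fejer_translates:
  assumes "L > 0"
  shows "(\<Sum>j<L. fejer L (s - real j / real L)) = 1"
proof -
  have "(\<Sum>j<L. \<Sum>k=1..<L. (real L - real k) * cos (real k * (2 * pi * (s - real j / real L))))
    = (\<Sum>k=1..<L. (real L - real k) * (\<Sum>j<L. cos (real k * (2 * pi * (s - real j / real L)))))"
    by (subst sum.swap) (simp add: sum_distrib_left)
  also have "\<dots> = 0" by (intro sum.neutral) (auto simp: sum_cos_translates_eq_0)
  finally have 0: "(\<Sum>j<L. \<Sum>k=1..<L. (real L - real k) * cos (real k * (2 * pi * (s - real j / real L)))) = 0" .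
  have "(\<Sum>j<L. fejer L (s - real j / real L)) = (real L * real L
      + 2 * (\<Sum>j<L. \<Sum>k=1..<L. (real L - real k) * cos (real k * (2 * pi * (s - real j / real L))))) / (real L)\<^sup>2"
    unfolding fejer_def by (simp add: sum.distrib flip: sum_divide_distrib sum_distrib_left)
  then show ?thesis using assms unfolding 0 by (simp add: power2_eq_square)
qed

lemma sum_symmetric_interval:
  fixes h :: "int \<Rightarrow> 'b::comm_monoid_add"
  assumes "L > 0"
  shows "(\<Sum>k\<in>{- int L<..<int L}. h k) = h 0 + (\<Sum>k=1..<L. h (int k) + h (- int k))"
  using assms
proof (induction L rule: nat_induct_non_zero)
  case 1
  have "{- int 1<..<int 1} = {0}" by auto
  then show ?case by simp
next
  case (Suc L)
  have "{- int (Suc L)<..<int (Suc L)} = insert (int L) (insert (- int L) {- int L<..<int L})" by auto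
  then show ?case using Suc by (simp add: algebra_simps)
qed

lemma fejer_eq_sum_cis:
  assumes "L > 0"
  shows "complex_of_real (fejer L s) =
    (\<Sum>k\<in>{- int L<..<int L}. complex_of_real ((real L - \<bar>of_int k\<bar>) / (real L)\<^sup>2) * cis (2 * pi * of_int k * s))"
proof -
  have cis: "cis (2 * pi * (of_int (int k)) * s) + cis (2 * pi * (of_int (- int k)) * s) = of_real (2 * cos (real k * (2 * pi * s)))" for k
    by (simp add: complex_eq_iff mult_ac)
  have "fejer L s = real L / (real L)\<^sup>2 + (\<Sum>k=1..<L. (real L - real k) / (real L)\<^sup>2 * (2 * cos (real k * (2 * pi * s))))"
    unfolding fejer_def add_divide_distrib sum_divide_distrib sum_distrib_left
    by (intro arg_cong2[of _ _ _ _ "(+)"] sum.cong) auto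
  then have "complex_of_real (fejer L s) = of_real (real L / (real L)\<^sup>2) +
     (\<Sum>k=1..<L. of_real ((real L - real k) / (real L)\<^sup>2) * of_real (2 * cos (real k * (2 * pi * s))))"
    by simp
  then show ?thesis
    unfolding sum_symmetric_interval[OF assms] cis[symmetric] distrib_left by simp
qed

lemma conj_fejer_eq_sum_cis:
  assumes "L > 0"
  shows "complex_of_real (conj_fejer L s) =
    (\<Sum>k\<in>{- int L<..<int L}. - \<i> * of_int (sgn k) * complex_of_real ((real L - \<bar>of_int k\<bar>) / (real L)\<^sup>2) * cis (2 * pi * of_int k * s))"
proof -
  have cis: "- \<i> * of_int (sgn (int k)) * complex_of_real c * cis (2 * pi * (of_int (int k)) * s)
      + - \<i> * of_int (sgn (- int k)) * complex_of_real c * cis (2 * pi * (of_int (- int k)) * s)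
     = of_real (c * (2 * sin (real k * (2 * pi * s))))" if "k \<ge> 1" for k c
    using that by (simp add: complex_eq_iff mult_ac)
  have "conj_fejer L s = (\<Sum>k=1..<L. (real L - real k) / (real L)\<^sup>2 * (2 * sin (real k * (2 * pi * s))))"
    unfolding conj_fejer_def sum_divide_distrib sum_distrib_left
    by (intro sum.cong) auto
  then have "complex_of_real (conj_fejer L s) =
     (\<Sum>k=1..<L. of_real ((real L - real k) / (real L)\<^sup>2 * (2 * sin (real k * (2 * pi * s)))))"
    by simp
  also have "\<dots> = (\<Sum>k=1..<L. - \<i> * of_int (sgn (int k)) * complex_of_real ((real L - \<bar>of_int (int k)\<bar>) / (real L)\<^sup>2) * cis (2 * pi * (of_int (int k)) * s)
      + - \<i> * of_int (sgn (- int k)) * complex_of_real ((real L - \<bar>of_int (- int k)\<bar>) / (real L)\<^sup>2) * cis (2 * pi * (of_int (- int k)) * s))"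
    by (intro sum.cong refl, subst cis[symmetric]) auto
  finally show ?thesis
    unfolding sum_symmetric_interval[OF assms] by simp
qed

lemma conj_fejer_primitive_deriv:
  "(conj_fejer_primitive L has_real_derivative conj_fejer L s) (at s within S)"
proof -
  have "((\<lambda>s. (real L - real k) * cos (real k * (2 * pi * s)) / (pi * real k))
     has_real_derivative - (2 * ((real L - real k) * sin (real k * (2 * pi * s))))) (at s within S)" if "k \<ge> 1" for k
    using that by (auto intro!: derivative_eq_intros simp: field_simps)
  then have "((\<lambda>s. - (\<Sum>k=1..<L. (real L - real k) * cos (real k * (2 * pi * s)) / (pi * real k)) / (real L)\<^sup>2)
     has_real_derivative - (\<Sum>k=1..<L. - (2 * ((real L - real k) * sin (real k * (2 * pi * s))))) / (real L)\<^sup>2)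
      (at s within S)"
    by (intro DERIV_cdivide DERIV_minus DERIV_sum) auto
  then show ?thesis
    by (simp add: conj_fejer_primitive_def[abs_def] conj_fejer_def sum_negf sum_distrib_left)
qed

text \<open>The source of the logarithmic gain. In the difference every summand is nonnegative and
  the odd frequencies carry the factor \<open>1 - cos (real k * pi) = 2\<close>. Keeping only the
  odd \<open>k\<close> below \<open>2 * n\<close>, where \<open>4 * n - k\<close> is at least
  \<open>2 * n\<close>, leaves a multiple of the harmonic sum.\<close>

lemma conj_fejer_primitive_half_ge:
  assumes "n > 0"
  shows "harm n / (8 * pi * real n) \<le> conj_fejer_primitive (4 * n) (1 / 2) - conj_fejer_primitive (4 * n) 0"
proof -
  define h where "h k = (4 * real n - real k) * (1 - cos (real k * pi)) / (pi * real k)" for k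
  have "real n * 2 / pi * harm n = (\<Sum>k=1..n. real n * 2 / (pi * real k))"
    by (simp add: harm_def sum_distrib_left field_simps)
  also have "\<dots> \<le> (\<Sum>k=1..n. h (2 * k - 1))"
  proof (rule sum_mono)
    fix k assume k: "k \<in> {1..n}"
    have "real (2 * k - 1) * pi = real k * (2 * pi) - pi" using k by (simp add: of_nat_diff algebra_simps)
    then have "cos (real (2 * k - 1) * pi) = -1"
      by (simp add: cos_diff) (metis cos_npi mult.assoc mult.commute mult_2 power2_eq_1_iff power_mult power_one_right cos_2npi)
    then have "h (2 * k - 1) = (4 * real n - real (2 * k - 1)) * 2 / (pi * real (2 * k - 1))"
      by (simp add: h_def)
    also have "\<dots> \<ge> (2 * real n) * 2 / (pi * (2 * real k))"
      using k by (intro frac_le mult_right_mono mult_left_mono mult_nonneg_nonneg mult_pos_pos) (auto simp: of_nat_diff)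
    finally show "real n * 2 / (pi * real k) \<le> h (2 * k - 1)" by (simp add: mult.commute)
  qed
  also have "\<dots> = (\<Sum>k\<in>(\<lambda>k. 2 * k - 1) ` {1..n}. h k)"
    by (subst sum.reindex) (auto simp: inj_on_def)
  also have "\<dots> \<le> (\<Sum>k=1..<4*n. h k)"
  proof (rule sum_mono2)
    fix k assume "k \<in> {1..<4*n} - (\<lambda>k. 2 * k - 1) ` {1..n}"
    then show "0 \<le> h k" unfolding h_def using cos_le_one[of "real k * pi"]
      by (intro divide_nonneg_nonneg mult_nonneg_nonneg) auto
  qed auto
  finally have "real n * 2 / pi * harm n / (4 * real n)\<^sup>2 \<le> (\<Sum>k=1..<4*n. h k) / (4 * real n)\<^sup>2"
    by (rule divide_right_mono) simp
  moreover have "real n * 2 / pi * harm n / (4 * real n)\<^sup>2 = harm n / (8 * pi * real n)"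
    using assms by (simp add: field_simps power2_eq_square)
  moreover have "(\<Sum>k=1..<4*n. h k) / (4 * real n)\<^sup>2 = conj_fejer_primitive (4 * n) (1 / 2) - conj_fejer_primitive (4 * n) 0"
  proof -
    have "conj_fejer_primitive (4 * n) (1 / 2) - conj_fejer_primitive (4 * n) 0
      = ((\<Sum>k=1..<4*n. (4 * real n - real k) / (pi * real k))
        - (\<Sum>k=1..<4*n. (4 * real n - real k) * cos (real k * pi) / (pi * real k))) / (4 * real n)\<^sup>2"
      by (simp add: conj_fejer_primitive_def diff_divide_distrib)
    then show ?thesis
      unfolding h_def sum_subtractf[symmetric] by (simp add: right_diff_distrib diff_divide_distrib)
  qed
  ultimately show ?thesis by simp
qed

section \<open>An upper estimate for consecutive frequency blocks\<close>

lemma integral_swap_real: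
  fixes f :: "real \<Rightarrow> real \<Rightarrow> real"
  assumes "continuous_on UNIV (\<lambda>(x, y). f x y)"
  shows "integral {a..b} (\<lambda>x. integral {c..d} (f x)) = integral {c..d} (\<lambda>y. integral {a..b} (\<lambda>x. f x y))"
  using integral_swap_continuous[of a c b d f] continuous_on_subset[OF assms]
  by (simp add: cbox_interval)

lemma continuous_on_integral_real:
  fixes f :: "real \<Rightarrow> real \<Rightarrow> real"
  assumes "continuous_on UNIV (\<lambda>(x, y). f x y)"
  shows "continuous_on S (\<lambda>x. integral {c..d} (f x))"
  using integral_continuous_on_param[of S c d f] continuous_on_subset[OF assms]
  by (simp add: cbox_interval)

lemma integral_unit_interval_partition:
  fixes f :: "real \<Rightarrow> real"
  assumes f: "continuous_on UNIV f" and L: "L > 0"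
  shows "(\<Sum>k<L. integral {real k / real L..real (Suc k) / real L} f) = integral {0..1} f"
proof -
  have "(\<Sum>k<m. integral {real k / real L..real (Suc k) / real L} f) = integral {0..real m / real L} f" for m
  proof (induction m)
    case (Suc m)
    have "f integrable_on {0..real (Suc m) / real L}"
      using continuous_on_subset[OF f] by (intro integrable_continuous_real) auto
    then have "integral {0..real m / real L} f + integral {real m / real L..real (Suc m) / real L} f
        = integral {0..real (Suc m) / real L} f"
      using L by (intro Henstock_Kurzweil_Integration.integral_combine) (auto simp: divide_right_mono)
    with Suc show ?case by simp
  qed simp
  from this[of L] show ?thesis using L by simp
qed

text \<open>Jensen's inequality on the unit interval for the function that equals \<open>g k\<close>
  on the \<open>k\<close>-th piece. That function may jump, so the tangent inequality at its mean
  norm \<open>a\<close> is integrated piece by piece.\<close>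

lemma powr_norm_sum_integral_le:
  fixes g :: "nat \<Rightarrow> real \<Rightarrow> 'a::banach"
  assumes p: "p > 1" and L: "L > 0" and g: "\<And>k. continuous_on UNIV (g k)"
  shows "norm (\<Sum>k<L. integral {real k / real L..real (Suc k) / real L} (g k)) powr p
     \<le> (\<Sum>k<L. integral {real k / real L..real (Suc k) / real L} (\<lambda>s. norm (g k s) powr p))"
proof -
  let ?D = "\<lambda>k. {real k / real L..real (Suc k) / real L}"
  have int: "h integrable_on S" if "continuous_on UNIV h" "S = {c..d}" for h :: "real \<Rightarrow> 'b::banach" and S c d
    using that continuous_on_subset[OF that(1)] by (auto intro!: integrable_continuous_real)
  define a where "a = (\<Sum>k<L. integral (?D k) (\<lambda>s. norm (g k s)))"
  have cn: "continuous_on UNIV (\<lambda>s. norm (g k s))" "continuous_on UNIV (\<lambda>s. norm (g k s) powr p)" for k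
    using g p by (auto intro!: continuous_intros)
  have le: "real k / real L \<le> real (Suc k) / real L" for k by (simp add: divide_right_mono)
  have a0: "a \<ge> 0" unfolding a_def
    by (intro sum_nonneg integral_nonneg int cn refl) auto
  have "norm (\<Sum>k<L. integral (?D k) (g k)) \<le> a"
    unfolding a_def
    by (intro sum_norm_le integral_norm_bound_integral int[OF _ refl] g cn) auto
  then have "norm (\<Sum>k<L. integral (?D k) (g k)) powr p \<le> a powr p"
    using p by (intro powr_mono2) auto
  also have "a powr p = (\<Sum>k<L. (a powr p - p * a powr (p - 1) * a) / real L
      + p * a powr (p - 1) * integral (?D k) (\<lambda>s. norm (g k s)))"
    using L unfolding sum.distrib sum_distrib_left[symmetric] a_def[symmetric] by simp
  also have "\<dots> = (\<Sum>k<L. integral (?D k) (\<lambda>s. (a powr p - p * a powr (p - 1) * a) + p * a powr (p - 1) * norm (g k s)))"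
  proof (rule sum.cong[OF refl])
    fix k
    have "integral (?D k) (\<lambda>s. (a powr p - p * a powr (p - 1) * a) + p * a powr (p - 1) * norm (g k s))
      = integral (?D k) (\<lambda>s. a powr p - p * a powr (p - 1) * a) + p * a powr (p - 1) * integral (?D k) (\<lambda>s. norm (g k s))"
      by (subst Henstock_Kurzweil_Integration.integral_add)
         (auto simp del: integral_const_real intro!: int[OF _ refl] continuous_on_mult_left cn)
    also have "integral (?D k) (\<lambda>s. a powr p - p * a powr (p - 1) * a) = (a powr p - p * a powr (p - 1) * a) / real L"
      using le[of k] by (subst integral_const_real) (simp add: add_divide_distrib)
    finally show "(a powr p - p * a powr (p - 1) * a) / real L
      + p * a powr (p - 1) * integral (?D k) (\<lambda>s. norm (g k s))
      = integral (?D k) (\<lambda>s. (a powr p - p * a powr (p - 1) * a) + p * a powr (p - 1) * norm (g k s))" by simp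
  qed
  also have "\<dots> \<le> (\<Sum>k<L. integral (?D k) (\<lambda>s. norm (g k s) powr p))"
  proof (intro sum_mono integral_le int[OF _ refl])
    fix k s
    show "a powr p - p * a powr (p - 1) * a + p * a powr (p - 1) * norm (g k s) \<le> norm (g k s) powr p"
      using powr_ge_tangent[OF p a0, of "norm (g k s)"] by (simp add: algebra_simps)
  qed (intro continuous_on_add continuous_on_mult_left continuous_on_const cn)+
  finally show ?thesis .
qed

lemma continuous_on_fejer [continuous_intros]:
  fixes f :: "'b::t2_space \<Rightarrow> real"
  shows "continuous_on S f \<Longrightarrow> continuous_on S (\<lambda>s. fejer L (f s))"
  unfolding fejer_def divide_inverse by (intro continuous_intros)

lemma continuous_on_conj_fejer [continuous_intros]:
  fixes f :: "'b::t2_space \<Rightarrow> real"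
  shows "continuous_on S f \<Longrightarrow> continuous_on S (\<lambda>s. conj_fejer L (f s))"
  unfolding conj_fejer_def divide_inverse by (intro continuous_intros)

lemma integral_conj_fejer:
  assumes "a \<le> b"
  shows "((\<lambda>s. conj_fejer L (s - c)) has_integral conj_fejer_primitive L (b - c) - conj_fejer_primitive L (a - c)) {a..b}"
proof (rule fundamental_theorem_of_calculus[OF assms])
  fix s
  have "((\<lambda>s. conj_fejer_primitive L (s - c)) has_real_derivative conj_fejer L (s - c)) (at s within {a..b})"
    by (rule DERIV_chain2[THEN DERIV_cong]) (auto intro!: derivative_eq_intros conj_fejer_primitive_deriv)
  then show "((\<lambda>s. conj_fejer_primitive L (s - c)) has_vector_derivative conj_fejer L (s - c)) (at s within {a..b})"
    by (simp add: has_real_derivative_iff_has_vector_derivative)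
qed

context riesz_bounded
begin

text \<open>As functions of \<open>s\<close> both sides are trigonometric polynomials with vector
  coefficients, and the left one is the Hilbert transform of the right one.\<close>

lemma Lp_norm_conj_fejer_le:
  fixes y :: "nat \<Rightarrow> 'a"
  assumes L: "L > 0"
  shows "Lp_norm p (\<lambda>s. \<Sum>j<N. conj_fejer L (s - real j / real L) *\<^sub>R y j)
    \<le> 3 * B * Lp_norm p (\<lambda>s. \<Sum>j<N. fejer L (s - real j / real L) *\<^sub>R y j)"
proof -
  define X where "X k = (\<Sum>j<N. (complex_of_real ((real L - \<bar>of_int k\<bar>) / (real L)\<^sup>2)
      * cis (2 * pi * of_int k * - (real j / real L))) *\<^sub>C y j)" for k
  let ?S = "{- int L<..<int L}"
  have cis: "cis (2 * pi * of_int k * (s - u)) = cis (2 * pi * of_int k * s) * cis (2 * pi * of_int k * - u)" for k s u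
    by (simp add: cis_mult algebra_simps)
  have cis1: "(c * cis (2 * pi * of_int k * (s - u))) *\<^sub>C v
      = cis (2 * pi * of_int k * s) *\<^sub>C (c * cis (2 * pi * of_int k * - u)) *\<^sub>C v" for c k s u and v :: 'a
    unfolding cis scaleC_scaleC by (simp only: mult.left_commute)
  have cis2: "(d * c * cis (2 * pi * of_int k * (s - u))) *\<^sub>C v
      = cis (2 * pi * of_int k * s) *\<^sub>C d *\<^sub>C (c * cis (2 * pi * of_int k * - u)) *\<^sub>C v" for d c k s u and v :: 'a
    unfolding cis scaleC_scaleC by (simp only: mult.left_commute mult.assoc)
  have "(\<Sum>j<N. fejer L (s - real j / real L) *\<^sub>R y j) = trig_poly ?S X s" for s
  proof -
    have "(\<Sum>j<N. fejer L (s - real j / real L) *\<^sub>R y j)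
      = (\<Sum>j<N. \<Sum>k\<in>?S. (complex_of_real ((real L - \<bar>of_int k\<bar>) / (real L)\<^sup>2) * cis (2 * pi * of_int k * (s - real j / real L))) *\<^sub>C y j)"
      unfolding scaleR_scaleC fejer_eq_sum_cis[OF L] scaleC.sum_left ..
    also have "\<dots> = (\<Sum>k\<in>?S. cis (2 * pi * of_int k * s) *\<^sub>C X k)"
      unfolding X_def scaleC.sum_right
      by (subst sum.swap, intro sum.cong refl cis1)
    finally show ?thesis by (simp add: trig_poly_def)
  qed
  moreover have "(\<Sum>j<N. conj_fejer L (s - real j / real L) *\<^sub>R y j)
      = trig_poly ?S (\<lambda>k. (- \<i> * of_int (sgn k)) *\<^sub>C X k) s" for s
  proof -
    have "(\<Sum>j<N. conj_fejer L (s - real j / real L) *\<^sub>R y j)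
      = (\<Sum>j<N. \<Sum>k\<in>?S. (- \<i> * of_int (sgn k) * complex_of_real ((real L - \<bar>of_int k\<bar>) / (real L)\<^sup>2) * cis (2 * pi * of_int k * (s - real j / real L))) *\<^sub>C y j)"
      unfolding scaleR_scaleC conj_fejer_eq_sum_cis[OF L] scaleC.sum_left ..
    also have "\<dots> = (\<Sum>k\<in>?S. cis (2 * pi * of_int k * s) *\<^sub>C (- \<i> * of_int (sgn k)) *\<^sub>C X k)"
      unfolding X_def scaleC.sum_right
      by (subst sum.swap, intro sum.cong refl cis2)
    finally show ?thesis by (simp add: trig_poly_def)
  qed
  ultimately show ?thesis
    using Lp_norm_trig_poly_conjugate[of ?S X] by (simp only: finite_greaterThanLessThan_int simp_thms)
qed

text \<open>Two norm estimates are combined through Fubini: the Hilbert transform acts in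
  \<open>s\<close> for fixed \<open>t\<close>, the cut \<open>Q\<close> acts in \<open>t\<close> for
  fixed \<open>s\<close>. Without the cuts the integral over \<open>s\<close> of the conjugate
  kernels would vanish by cancellation; the moving cut keeps each kernel only on the half circle
  that follows its centre.\<close>

lemma Lp_norm_sum_le_half_circle:
  fixes f :: "nat \<Rightarrow> real \<Rightarrow> 'a"
  assumes N: "N > 0" and M: "M \<ge> 0" and Q: "Q \<ge> 0"
    and cont: "\<And>j. continuous_on UNIV (f j)"
    and f: "\<And>j. j < N \<Longrightarrow> Lp_norm p (f j) \<le> M"
    and cut: "\<And>c a b. a \<le> b \<Longrightarrow> b \<le> N \<Longrightarrow>
       Lp_norm p (\<lambda>t. \<Sum>j\<in>{a..<b}. c j *\<^sub>R f j t) \<le> Q * Lp_norm p (\<lambda>t. \<Sum>j<N. c j *\<^sub>R f j t)"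
    and \<delta>: "\<delta> = conj_fejer_primitive (2 * N) (1 / 2) - conj_fejer_primitive (2 * N) 0" "\<delta> > 0"
  shows "\<delta> * Lp_norm p (\<lambda>t. \<Sum>j<N. f j t) \<le> 3 * B * Q * M"
proof -
  define L where "L = 2 * N"
  have L: "L > 0" using N by (simp add: L_def)
  \<comment> \<open>With truncated subtraction this is the set of \<open>j < N\<close> with
    \<open>j \<le> k < j + N\<close>. It is an interval of indices, so \<open>cut\<close> applies,
    and \<open>f j\<close> survives exactly on the pieces between \<open>j / L\<close> and
    \<open>(j + N) / L\<close>, an interval of length 1/2 inside the unit interval.\<close>
  define A where "A k = {k + 1 - N..<min (k + 1) N}" for k
  define D where "D k = {real k / real L..real (Suc k) / real L}" for k
  define F where "F s t = (\<Sum>j<N. fejer L (s - real j / real L) *\<^sub>R f j t)" for s t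
  define G where "G s t = (\<Sum>j<N. conj_fejer L (s - real j / real L) *\<^sub>R f j t)" for s t
  define H where "H k s t = (\<Sum>j\<in>A k. conj_fejer L (s - real j / real L) *\<^sub>R f j t)" for k s t
  have f_cont [continuous_intros]: "continuous_on S (\<lambda>z. f j (h z))" if "continuous_on S h" for S h j
    using continuous_on_compose2[OF cont that] by auto
  have cF: "continuous_on S (\<lambda>z. F (u z) (v z))" and cG: "continuous_on S (\<lambda>z. G (u z) (v z))"
    and cH: "continuous_on S (\<lambda>z. H k (u z) (v z))"
    if "continuous_on S u" "continuous_on S v" for S k and u v :: "'z::t2_space \<Rightarrow> real"
    using that unfolding F_def G_def H_def by (auto intro!: continuous_intros)
  note [continuous_intros] = cF cG cH
  have le: "real k / real L \<le> real (Suc k) / real L" for k by (simp add: divide_right_mono)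
  \<comment> \<open>Exchanging the sums over \<open>k\<close> and \<open>j\<close> makes the
    integrals for each \<open>j\<close> telescope to the same number
    \<open>\<delta>\<close>.\<close>
  have recon: "(\<Sum>k<L. integral (D k) (\<lambda>s. H k s t)) = \<delta> *\<^sub>R (\<Sum>j<N. f j t)" for t
  proof -
    define W where "W j k = conj_fejer_primitive L ((real k - real j) / real L)" for j k
    have "((\<lambda>s. H k s t) has_integral (\<Sum>j\<in>A k. (W j (Suc k) - W j k) *\<^sub>R f j t)) (D k)" for k
      unfolding H_def D_def W_def diff_divide_distrib
      by (intro has_integral_sum has_integral_scaleR_left integral_conj_fejer le) (auto simp: A_def)
    then have "(\<Sum>k<L. integral (D k) (\<lambda>s. H k s t)) = (\<Sum>k<L. \<Sum>j\<in>A k. (W j (Suc k) - W j k) *\<^sub>R f j t)"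
      by (intro sum.cong refl integral_unique)
    also have "\<dots> = (\<Sum>k<L. \<Sum>j | j \<in> {..<N} \<and> j \<le> k \<and> k < j + N. (W j (Suc k) - W j k) *\<^sub>R f j t)"
      by (intro sum.cong refl) (auto simp: A_def)
    also have "\<dots> = (\<Sum>j<N. \<Sum>k | k \<in> {..<L} \<and> j \<le> k \<and> k < j + N. (W j (Suc k) - W j k) *\<^sub>R f j t)"
      by (rule sum.swap_restrict) auto
    also have "\<dots> = (\<Sum>j<N. \<Sum>k=j..<j+N. (W j (Suc k) - W j k) *\<^sub>R f j t)"
      by (intro sum.cong refl) (auto simp: L_def)
    also have "\<dots> = (\<Sum>j<N. (W j (j + N) - W j j) *\<^sub>R f j t)"
      by (simp add: sum_Suc_diff' flip: scaleR_left.sum)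
    also have "\<dots> = \<delta> *\<^sub>R (\<Sum>j<N. f j t)"
      using N by (simp add: W_def \<delta> L_def scaleR_sum_right)
    finally show ?thesis .
  qed
  have cQ: "continuous_on S (\<lambda>t. \<Sum>j<N. f j t)" for S by (intro continuous_intros)
  have P: "p > 0" by (rule p_pos)
  have "(\<delta> * Lp_norm p (\<lambda>t. \<Sum>j<N. f j t)) powr p = \<delta> powr p * integral {0..1} (\<lambda>t. norm (\<Sum>j<N. f j t) powr p)"
    using \<delta> P cQ by (simp add: powr_mult Lp_norm_nonneg Lp_norm_powr)
  also have "\<dots> = integral {0..1} (\<lambda>t. norm (\<delta> *\<^sub>R (\<Sum>j<N. f j t)) powr p)"
    using \<delta>(2) by (simp add: powr_mult)
  also have "\<dots> \<le> integral {0..1} (\<lambda>t. \<Sum>k<L. integral (D k) (\<lambda>s. norm (H k s t) powr p))"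
  proof (rule integral_le)
    show "(\<lambda>t. \<Sum>k<L. integral (D k) (\<lambda>s. norm (H k s t) powr p)) integrable_on {0..1}"
      unfolding D_def using P
      by (intro integrable_continuous_real continuous_on_sum continuous_on_integral_real)
         (auto intro!: continuous_intros simp: case_prod_unfold)
    fix t :: real
    show "norm (\<delta> *\<^sub>R (\<Sum>j<N. f j t)) powr p \<le> (\<Sum>k<L. integral (D k) (\<lambda>s. norm (H k s t) powr p))"
      unfolding recon[symmetric] D_def
      by (rule powr_norm_sum_integral_le[OF p_gt_1 L]) (intro continuous_intros)
  qed (intro integrable_continuous_real continuous_on_norm_powr continuous_on_scaleR continuous_on_const cQ P)
  also have "\<dots> = (\<Sum>k<L. integral {0..1} (\<lambda>t. integral (D k) (\<lambda>s. norm (H k s t) powr p)))"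
    unfolding D_def using P
    by (intro integral_sum integrable_continuous_real continuous_on_integral_real)
       (auto intro!: continuous_intros simp: case_prod_unfold)
  also have "\<dots> = (\<Sum>k<L. integral (D k) (\<lambda>s. integral {0..1} (\<lambda>t. norm (H k s t) powr p)))"
    unfolding D_def using P
    by (intro sum.cong refl integral_swap_real) (auto intro!: continuous_intros simp: case_prod_unfold)
  \<comment> \<open>For fixed \<open>s\<close> in the \<open>k\<close>-th piece,
    \<open>H k s\<close> is a cut of \<open>G s\<close> to consecutive indices.\<close>
  also have "\<dots> \<le> (\<Sum>k<L. integral (D k) (\<lambda>s. Q powr p * integral {0..1} (\<lambda>t. norm (G s t) powr p)))"
    unfolding D_def
  proof (intro sum_mono integral_le)
    fix k s assume "k \<in> {..<L}"
    then have "Lp_norm p (H k s) \<le> Q * Lp_norm p (G s)"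
      unfolding H_def G_def A_def by (intro cut) (auto simp: L_def)
    then have "Lp_norm p (H k s) powr p \<le> (Q * Lp_norm p (G s)) powr p"
      using P by (intro powr_mono2) (auto simp: Lp_norm_nonneg)
    then show "integral {0..1} (\<lambda>t. norm (H k s t) powr p) \<le> Q powr p * integral {0..1} (\<lambda>t. norm (G s t) powr p)"
      using P Q by (simp add: powr_mult Lp_norm_nonneg Lp_norm_powr continuous_intros)
  qed (use P in \<open>auto intro!: integrable_continuous_real continuous_on_integral_real continuous_intros simp: case_prod_unfold\<close>)
  also have "\<dots> = integral {0..1} (\<lambda>s. Q powr p * integral {0..1} (\<lambda>t. norm (G s t) powr p))"
    unfolding D_def using P
    by (intro integral_unit_interval_partition L)
       (auto intro!: continuous_on_integral_real continuous_intros simp: case_prod_unfold)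
  also have "\<dots> = Q powr p * integral {0..1} (\<lambda>t. integral {0..1} (\<lambda>s. norm (G s t) powr p))"
    using P by (subst integral_swap_real) (auto intro!: continuous_intros simp: case_prod_unfold)
  \<comment> \<open>For fixed \<open>t\<close> the values \<open>f j t\<close> are plain vectors,
    and \<open>G\<close> is the Hilbert transform of \<open>F\<close> in the variable
    \<open>s\<close>.\<close>
  also have "\<dots> \<le> Q powr p * integral {0..1} (\<lambda>t. (3 * B) powr p * integral {0..1} (\<lambda>s. norm (F s t) powr p))"
  proof (intro mult_left_mono integral_le)
    fix t
    have "Lp_norm p (\<lambda>s. G s t) \<le> 3 * B * Lp_norm p (\<lambda>s. F s t)"
      unfolding G_def F_def by (rule Lp_norm_conj_fejer_le[OF L])
    then have "Lp_norm p (\<lambda>s. G s t) powr p \<le> (3 * B * Lp_norm p (\<lambda>s. F s t)) powr p"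
      using P by (intro powr_mono2) (auto simp: Lp_norm_nonneg)
    then show "integral {0..1} (\<lambda>s. norm (G s t) powr p) \<le> (3 * B) powr p * integral {0..1} (\<lambda>s. norm (F s t) powr p)"
      using P B_pos by (simp add: powr_mult Lp_norm_nonneg Lp_norm_powr continuous_intros)
  qed (use P in \<open>auto intro!: integrable_continuous_real continuous_on_integral_real continuous_intros simp: case_prod_unfold\<close>)
  also have "\<dots> = Q powr p * (3 * B) powr p * integral {0..1} (\<lambda>s. integral {0..1} (\<lambda>t. norm (F s t) powr p))"
    using P by (subst integral_swap_real) (auto intro!: continuous_intros simp: case_prod_unfold)
  \<comment> \<open>For fixed \<open>s\<close> the weights of \<open>F s\<close> are nonnegative
    with sum at most 1, being half of a partition of unity.\<close>
  also have "\<dots> \<le> Q powr p * (3 * B) powr p * integral {0..1} (\<lambda>s::real. M powr p)"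
  proof (intro mult_left_mono integral_le)
    fix s
    have "Lp_norm p (\<lambda>t. \<Sum>j<N. complex_of_real (fejer L (s - real j / real L)) *\<^sub>C f j t)
      \<le> (\<Sum>j<N. cmod (complex_of_real (fejer L (s - real j / real L)))) * M"
      using f M cont continuous_on_subset by (intro Lp_norm_sum_le p_gt_1) blast+
    also have "\<dots> = (\<Sum>j<N. fejer L (s - real j / real L)) * M"
      by (simp add: fejer_nonneg)
    also have "\<dots> \<le> (\<Sum>j<L. fejer L (s - real j / real L)) * M"
      using M by (intro mult_right_mono sum_mono2) (auto simp: L_def fejer_nonneg)
    also have "\<dots> = M" by (simp add: sum_fejer_translates[OF L])
    finally have "Lp_norm p (F s) \<le> M" by (simp add: F_def[abs_def] scaleR_scaleC)
    then show "integral {0..1} (\<lambda>t. norm (F s t) powr p) \<le> M powr p"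
      using P M by (subst Lp_norm_le_iff[symmetric]) (auto intro!: continuous_intros)
  qed (use P in \<open>auto intro!: integrable_continuous_real continuous_on_integral_real continuous_intros simp: case_prod_unfold\<close>)
  also have "\<dots> = (3 * B * Q * M) powr p"
    using Q M B_pos by (simp add: powr_mult)
  finally have "(\<delta> * Lp_norm p (\<lambda>t. \<Sum>j<N. f j t)) powr p \<le> (3 * B * Q * M) powr p" .
  moreover have "0 \<le> 3 * B * Q * M" using Q M B_pos by simp
  ultimately show ?thesis
    using P powr_less_mono2[of p "3 * B * Q * M" "\<delta> * Lp_norm p (\<lambda>t. \<Sum>j<N. f j t)"] by linarith
qed

end

text \<open>For \<open>n\<close> in a block the \<open>LEAST\<close> expression is the index of that
  block, also when other blocks are empty. Thus scaling whole blocks amounts to changing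
  coefficients, and a sum over consecutive blocks is an interval cut.\<close>

lemma trig_poly_scale_blocks:
  fixes m :: "nat \<Rightarrow> int" and x :: "int \<Rightarrow> 'a::complex_banach"
  assumes m: "mono m" and ab: "a \<le> b"
  shows "trig_poly {m a..<m b} (\<lambda>n. c (LEAST j. n < m (Suc j)) *\<^sub>R x n) t
    = (\<Sum>j=a..<b. c j *\<^sub>R trig_poly {m j..<m (Suc j)} x t)"
proof -
  define x' where "x' n = c (LEAST j. n < m (Suc j)) *\<^sub>R x n" for n
  have "trig_poly {m a..<m b} x' t = (\<Sum>j=a..<b. c j *\<^sub>R trig_poly {m j..<m (Suc j)} x t)"
    using ab
  proof (induction b rule: dec_induct)
    case base
    show ?case by (simp add: trig_poly_def)
  next
    case (step b)
    have "x' n = c b *\<^sub>R x n" if n: "n \<in> {m b..<m (Suc b)}" for n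
    proof -
      have "(LEAST j. n < m (Suc j)) = b"
      proof (rule Least_equality)
        fix j assume "n < m (Suc j)"
        with n have "m b < m (Suc j)" by simp
        then have "\<not> Suc j \<le> b" using monoD[OF m, of "Suc j" b] by auto
        then show "b \<le> j" by simp
      qed (use n in simp)
      then show ?thesis by (simp add: x'_def)
    qed
    then have "trig_poly {m b..<m (Suc b)} x' t = c b *\<^sub>R trig_poly {m b..<m (Suc b)} x t"
      by (simp add: trig_poly_def scaleR_sum_right scaleC.scaleR_right)
    moreover have "{m a..<m (Suc b)} = {m a..<m b} \<union> {m b..<m (Suc b)}"
      using monoD[OF m, of a b] monoD[OF m, of b "Suc b"] step by (intro ivl_disj_un(17)[symmetric]) auto
    moreover have "trig_poly ({m a..<m b} \<union> {m b..<m (Suc b)}) x' t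
      = trig_poly {m a..<m b} x' t + trig_poly {m b..<m (Suc b)} x' t"
      by (rule trig_poly_Un) auto
    ultimately show ?case using step by simp
  qed
  then show ?thesis by (simp only: x'_def[abs_def])
qed

context riesz_bounded
begin

lemma ex_block_estimate:
  obtains N :: nat where "N \<ge> 8"
    and "\<And>m (x :: int \<Rightarrow> 'a) M. mono m \<Longrightarrow> (\<And>j. j < N \<Longrightarrow> Lp_norm p (trig_poly {m j..<m (Suc j)} x) \<le> M)
      \<Longrightarrow> Lp_norm p (trig_poly {m 0..<m N} x) \<le> real N / 2 * M"
proof -
  have "eventually (\<lambda>n. harm n \<ge> 48 * pi * B ^ 3) sequentially"
    using harm_at_top by (simp add: filterlim_at_top)
  \<comment> \<open>With cut constant \<open>2 * B\<^sup>2\<close> the previous estimate loses the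
    factor \<open>6 * B ^ 3 / \<delta>\<close>. Since \<open>\<delta>\<close> is at least
    \<open>harm n / (8 * pi * n)\<close>, this choice makes the factor at most
    \<open>n = N / 2\<close>.\<close>
  then obtain n :: nat where n: "harm n \<ge> 48 * pi * B ^ 3" "n \<ge> 4"
    by (metis eventually_sequentially nat_le_linear)
  define N where "N = 2 * n"
  define \<delta> where "\<delta> = conj_fejer_primitive (2 * N) (1 / 2) - conj_fejer_primitive (2 * N) 0"
  have "harm n / (8 * pi * real n) \<le> \<delta>"
    using conj_fejer_primitive_half_ge[of n] n by (simp add: \<delta>_def N_def)
  moreover have "6 * B ^ 3 / real n \<le> harm n / (8 * pi * real n)"
    using n by (simp add: field_simps)
  ultimately have \<delta>: "6 * B ^ 3 / real n \<le> \<delta>" by simp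
  have "0 < 6 * B ^ 3 / real n" using n B_pos by simp
  with \<delta> have \<delta>0: "\<delta> > 0" by linarith
  show ?thesis
  proof
    show "N \<ge> 8" using n by (simp add: N_def)
    fix m :: "nat \<Rightarrow> int" and x :: "int \<Rightarrow> 'a" and M
    assume m: "mono m" and M: "\<And>j. j < N \<Longrightarrow> Lp_norm p (trig_poly {m j..<m (Suc j)} x) \<le> M"
    have M0: "M \<ge> 0" using order_trans[OF Lp_norm_nonneg M[of 0]] n by (simp add: N_def)
    define f where "f j = trig_poly {m j..<m (Suc j)} x" for j
    have "Lp_norm p (\<lambda>t. \<Sum>j=a..<b. c j *\<^sub>R f j t) \<le> 2 * B\<^sup>2 * Lp_norm p (\<lambda>t. \<Sum>j<N. c j *\<^sub>R f j t)"
      if "a \<le> b" "b \<le> N" for a b c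
    proof -
      define x' where "x' n = c (LEAST j. n < m (Suc j)) *\<^sub>R x n" for n
      have x': "(\<lambda>t. \<Sum>j=a..<b. c j *\<^sub>R f j t) = trig_poly {m a..<m b} x'" if "a \<le> b" for a b
        using trig_poly_scale_blocks[OF m that, of c x] by (simp add: fun_eq_iff f_def x'_def[abs_def])
      have "{m a..<m b} \<subseteq> {m 0..<m N}" using that monoD[OF m, of 0 a] monoD[OF m, of b N] by auto
      from Lp_norm_trig_poly_interval[OF _ this, of x'] show ?thesis
        using that x'[of a b] x'[of 0 N] by (simp add: atLeast0LessThan)
    qed
    then have "\<delta> * Lp_norm p (\<lambda>t. \<Sum>j<N. f j t) \<le> 3 * B * (2 * B\<^sup>2) * M"
      using n M0 B_pos \<delta>0 M by (intro Lp_norm_sum_le_half_circle) (auto simp: f_def N_def \<delta>_def intro!: continuous_intros)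
    also have "\<dots> = (6 * B ^ 3 / real n) * (real N / 2 * M)"
      using n by (simp add: N_def power2_eq_square power3_eq_cube)
    also have "\<dots> \<le> \<delta> * (real N / 2 * M)"
      using \<delta> M0 by (intro mult_right_mono) auto
    finally have "Lp_norm p (\<lambda>t. \<Sum>j<N. f j t) \<le> real N / 2 * M" using \<delta>0 by simp
    moreover have "(\<lambda>t. \<Sum>j<N. f j t) = trig_poly {m 0..<m N} x"
      using trig_poly_scale_blocks[OF m, of 0 N "\<lambda>_. 1" x] by (simp add: fun_eq_iff f_def atLeast0LessThan)
    ultimately show "Lp_norm p (trig_poly {m 0..<m N} x) \<le> real N / 2 * M" by simp
  qed
qed

text \<open>Abel summation: a multiplier of bounded variation turns the polynomial into a
  combination of its initial segments, weighted by the increments of \<open>\<mu>\<close>. It serves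
  to divide out slowly varying weights.\<close>

lemma Lp_norm_trig_poly_multiplier:
  fixes y :: "int \<Rightarrow> 'a" and \<mu> :: "nat \<Rightarrow> real"
  assumes M: "\<And>i. i \<le> n \<Longrightarrow> Lp_norm p (trig_poly {a..<a + int i} y) \<le> M"
  shows "Lp_norm p (trig_poly {a..<a + int n} (\<lambda>l. \<mu> (nat (l - a)) *\<^sub>R y l))
    \<le> (\<bar>\<mu> n\<bar> + (\<Sum>i<n. \<bar>\<mu> i - \<mu> (Suc i)\<bar>)) * M"
proof -
  have M0: "M \<ge> 0" using M[of 0] Lp_norm_nonneg order_trans by blast
  define w where "w i = complex_of_real (if i = n then \<mu> n else \<mu> i - \<mu> (Suc i))" for i
  \<comment> \<open>Index \<open>i < n\<close> stands for the segment of length \<open>i + 1\<close>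
    with an increment as weight; index \<open>n\<close> is the whole polynomial with the boundary
    weight \<open>\<mu> n\<close>.\<close>
  define g where "g i = trig_poly {a..<a + int (if i = n then n else Suc i)} y" for i
  have step: "trig_poly {a..<a + int (Suc n)} x t = trig_poly {a..<a + int n} x t + cis (2 * pi * of_int (a + int n) * t) *\<^sub>C x (a + int n)"
    for n x t
  proof -
    have "{a..<a + int (Suc n)} = insert (a + int n) {a..<a + int n}" by auto
    then show ?thesis by (simp add: trig_poly_def add.commute)
  qed
  have "trig_poly {a..<a + int n} (\<lambda>l. \<mu> (nat (l - a)) *\<^sub>R y l) t
     = \<mu> n *\<^sub>R trig_poly {a..<a + int n} y t + (\<Sum>i<n. (\<mu> i - \<mu> (Suc i)) *\<^sub>R trig_poly {a..<a + int (Suc i)} y t)" for n t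
  proof (induction n)
    case (Suc n)
    then show ?case by (simp add: step algebra_simps scaleC.scaleR_right del: of_nat_Suc)
  qed (simp add: trig_poly_def)
  then have "trig_poly {a..<a + int n} (\<lambda>l. \<mu> (nat (l - a)) *\<^sub>R y l) t = (\<Sum>i\<le>n. w i *\<^sub>C g i t)" for t
    unfolding lessThan_Suc_atMost[symmetric] by (simp add: w_def g_def scaleR_scaleC)
  then have "Lp_norm p (trig_poly {a..<a + int n} (\<lambda>l. \<mu> (nat (l - a)) *\<^sub>R y l))
      = Lp_norm p (\<lambda>t. \<Sum>i\<le>n. w i *\<^sub>C g i t)"
    by presburger
  also have "\<dots> \<le> (\<Sum>i\<le>n. cmod (w i)) * M"
    using M0 by (intro Lp_norm_sum_le p_gt_1) (auto simp: g_def intro!: continuous_intros M simp del: of_nat_Suc)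
  also have "(\<Sum>i\<le>n. cmod (w i)) = \<bar>\<mu> n\<bar> + (\<Sum>i<n. \<bar>\<mu> i - \<mu> (Suc i)\<bar>)"
    unfolding lessThan_Suc_atMost[symmetric] by (simp add: w_def flip: of_real_diff)
  finally show ?thesis .
qed

end

locale block_bounded = riesz_bounded p B ty for p B :: real and ty :: "'a::complex_banach itself" +
  fixes N :: nat
  assumes N_ge_8: "N \<ge> 8"
    and block: "mono m \<Longrightarrow> (\<And>j. j < N \<Longrightarrow> Lp_norm p (trig_poly {m j..<m (Suc j)} (x :: int \<Rightarrow> 'a)) \<le> M)
      \<Longrightarrow> Lp_norm p (trig_poly {m 0..<m N} x) \<le> real N / 2 * M"
begin

text \<open>Iteration of \<open>block\<close>: the pieces are grouped into \<open>N\<close> runs of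
  \<open>N ^ i\<close> adjacent pieces, and each level gains a factor 1/2 over the triangle
  inequality.\<close>

lemma Lp_norm_trig_poly_blocks:
  fixes x :: "int \<Rightarrow> 'a"
  assumes "\<And>j. j < N ^ i \<Longrightarrow> Lp_norm p (trig_poly {a + int (j * w)..<a + int (Suc j * w)} x) \<le> M"
  shows "Lp_norm p (trig_poly {a..<a + int (N ^ i * w)} x) \<le> (real N / 2) ^ i * M"
  using assms
proof (induction i arbitrary: a)
  case 0
  from 0[of 0] show ?case by simp
next
  case (Suc i)
  define m where "m j = a + int (j * (N ^ i * w))" for j
  have "Lp_norm p (trig_poly {m j..<m (Suc j)} x) \<le> (real N / 2) ^ i * M" if j: "j < N" for j
  proof -
    have "Lp_norm p (trig_poly {m j..<m j + int (N ^ i * w)} x) \<le> (real N / 2) ^ i * M"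
    proof (rule Suc.IH)
      fix k assume k: "k < N ^ i"
      have "j * N ^ i + k < Suc j * N ^ i" using k by simp
      also have "\<dots> \<le> N ^ Suc i" using j by (simp only: power_Suc mult_le_mono1 Suc_leI)
      finally have "Lp_norm p (trig_poly {a + int ((j * N ^ i + k) * w)..<a + int (Suc (j * N ^ i + k) * w)} x) \<le> M"
        by (rule Suc.prems)
      then show "Lp_norm p (trig_poly {m j + int (k * w)..<m j + int (Suc k * w)} x) \<le> M"
        by (simp add: m_def algebra_simps)
    qed
    then show ?thesis by (simp add: m_def algebra_simps)
  qed
  moreover have "mono m" unfolding m_def by (intro monoI) (simp add: mult_right_mono)
  ultimately have "Lp_norm p (trig_poly {m 0..<m N} x) \<le> real N / 2 * ((real N / 2) ^ i * M)"
    by (rule block[rotated])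
  then show ?case by (simp add: m_def mult.assoc)
qed

end

section \<open>Weights from the strong Kreiss condition\<close>

text \<open>Multiplying the series by a geometric series raises \<open>m\<close> by one; the
  coefficients follow from the hockey-stick identity.\<close>

lemma negative_binomial_sums:
  fixes q :: real
  assumes "0 \<le> q" "q < 1"
  shows "(\<lambda>k. real (m + k choose k) * q ^ k) sums (1 / (1 - q) ^ Suc m)"
proof (induction m)
  case 0
  show ?case using geometric_sums[of q] assms by simp
next
  case (Suc m)
  have "(\<lambda>k. \<Sum>i\<le>k. (real (m + i choose i) * q ^ i) * q ^ (k - i)) sums
      ((\<Sum>k. real (m + k choose k) * q ^ k) * (\<Sum>k. q ^ k))"
    using assms Suc by (intro Cauchy_product_sums) (auto simp: summable_geometric intro: sums_summable)
  moreover have "(\<Sum>i\<le>k. (real (m + i choose i) * q ^ i) * q ^ (k - i)) = real (Suc m + k choose k) * q ^ k" for k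
  proof -
    have "(\<Sum>i\<le>k. (real (m + i choose i) * q ^ i) * q ^ (k - i)) = (\<Sum>i\<le>k. real (m + i choose i) * q ^ k)"
      by (intro sum.cong refl) (simp flip: power_add)
    also have "\<dots> = real (\<Sum>i\<le>k. m + i choose i) * q ^ k" by (simp add: sum_distrib_right)
    finally show ?thesis by (simp add: sum_choose_lower)
  qed
  ultimately show ?case
    using Suc assms by (simp add: sums_iff suminf_geometric)
qed

lemma choose_le_pow2: "n choose k \<le> 2 ^ n"
  using member_le_sum[of k "{..n}" "(choose) n"] choose_row_sum[of n]
  by (cases "k \<le> n") (auto simp: binomial_eq_0)

lemma Suc_times_binomial_shift: "Suc k * (m + Suc k choose Suc k) = Suc m * (Suc m + k choose k)"
  using Suc_times_binomial_eq[of "m + k" k] binomial_absorb_comp[of "Suc m + k" k] by (simp add: mult.commute)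

text \<open>A factor \<open>k\<close> is traded for a shift of \<open>k\<close> and the next
  parameter \<open>m + 1\<close>, so the factorial moments reduce to total masses.\<close>

lemma Suc_times_negative_binomial:
  fixes q :: real
  shows "real (Suc k) * (real (m + Suc k choose Suc k) * q ^ Suc k) = (real (Suc m) * q) * (real (Suc m + k choose k) * q ^ k)"
proof -
  have "real (Suc k) * real (m + Suc k choose Suc k) = real (Suc m) * real (Suc m + k choose k)"
    unfolding of_nat_mult[symmetric] Suc_times_binomial_shift ..
  then have "real (Suc k) * real (m + Suc k choose Suc k) * (q * q ^ k) = real (Suc m) * real (Suc m + k choose k) * (q * q ^ k)"
    by (rule arg_cong)
  then show ?thesis by (simp only: power_Suc mult_ac)
qed

lemma negative_binomial_mean_sums:
  fixes q :: real
  assumes "0 \<le> q" "q < 1"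
  shows "(\<lambda>k. real k * (real (m + k choose k) * q ^ k)) sums (real (Suc m) * q / (1 - q) ^ (m + 2))"
proof -
  have "(\<lambda>k. (real (Suc m) * q) * (real (Suc m + k choose k) * q ^ k)) sums ((real (Suc m) * q) * (1 / (1 - q) ^ Suc (Suc m)))"
    using assms by (intro sums_mult negative_binomial_sums)
  then have "(\<lambda>k. real (Suc k) * (real (m + Suc k choose Suc k) * q ^ Suc k)) sums (real (Suc m) * q / (1 - q) ^ (m + 2))"
    unfolding Suc_times_negative_binomial by simp
  from sums_Suc[OF this] show ?thesis by simp
qed

lemma negative_binomial_second_moment_sums:
  fixes q :: real
  assumes "0 \<le> q" "q < 1"
  shows "(\<lambda>k. real k * (real k - 1) * (real (m + k choose k) * q ^ k)) sums
    (real (Suc m) * real (Suc (Suc m)) * q\<^sup>2 / (1 - q) ^ (m + 3))"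
proof -
  have "(\<lambda>k. (real (Suc m) * q) * (real k * (real (Suc m + k choose k) * q ^ k))) sums
     ((real (Suc m) * q) * (real (Suc (Suc m)) * q / (1 - q) ^ (Suc m + 2)))"
    using assms by (intro sums_mult negative_binomial_mean_sums)
  moreover have "(real (Suc m) * q) * (real k * (real (Suc m + k choose k) * q ^ k))
     = real (Suc k) * (real (Suc k) - 1) * (real (m + Suc k choose Suc k) * q ^ Suc k)" for k
  proof -
    have "real (Suc k) * (real (Suc k) - 1) * (real (m + Suc k choose Suc k) * q ^ Suc k)
        = real k * (real (Suc k) * (real (m + Suc k choose Suc k) * q ^ Suc k))" by simp
    then show ?thesis unfolding Suc_times_negative_binomial by (simp only: mult_ac)
  qed
  ultimately have "(\<lambda>k. real (Suc k) * (real (Suc k) - 1) * (real (m + Suc k choose Suc k) * q ^ Suc k)) sums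
      ((real (Suc m) * q) * (real (Suc (Suc m)) * q / (1 - q) ^ (Suc m + 2)))" by (simp only:)
  from sums_Suc[OF this] show ?thesis by (simp add: power2_eq_square mult_ac numeral_3_eq_3)
qed

section \<open>Powers of an operator and of its resolvent\<close>

lemma bounded_clinear_funpow: "bounded_clinear T \<Longrightarrow> bounded_clinear (T ^^ n)"
proof (induction n)
  case 0
  show ?case by (simp add: bounded_clinear_def bounded_linear_ident id_def)
next
  case (Suc n)
  then show ?case using bounded_linear_compose[of T "T ^^ n"] by (simp add: bounded_clinear_def o_def)
qed

lemma resolvent_eqI:
  assumes "l \<in> resolvent_set T"
  shows "bounded_clinear (resolvent T l)" "resolvent T l (l *\<^sub>C x - T x) = x"
proof -
  from assms obtain R where R: "bounded_clinear R" "\<And>x. R (l *\<^sub>C x - T x) = x" "\<And>x. l *\<^sub>C R x - T (R x) = x"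
    by (auto simp: resolvent_set_def)
  then have "resolvent T l = R" unfolding resolvent_def by (intro inv_equality)
  with R show "bounded_clinear (resolvent T l)" "resolvent T l (l *\<^sub>C x - T x) = x" by auto
qed

context
  fixes K :: real and T :: "'a::complex_banach \<Rightarrow> 'a"
  assumes T: "strongly_Kreiss_bounded K T"
begin

lemma Kreiss_clinear: "bounded_clinear (T ^^ n)"
  using T by (intro bounded_clinear_funpow) (simp add: strongly_Kreiss_bounded_def)

lemma Kreiss_scaleC: "(T ^^ n) (c *\<^sub>C x) = c *\<^sub>C (T ^^ n) x"
  using Kreiss_clinear[of n] by (simp add: bounded_clinear_def)

lemma Kreiss_bounded_linear: "bounded_linear (T ^^ n)"
  using Kreiss_clinear[of n] by (simp add: bounded_clinear_def)

lemma Kreiss_constant_nonneg: "K \<ge> 0"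
proof -
  have "bounded_clinear (resolvent T 2 ^^ 1)"
    using T resolvent_eqI(1)[of 2 T] by (intro bounded_clinear_funpow) (auto simp: strongly_Kreiss_bounded_def)
  then have "0 \<le> onorm (resolvent T 2 ^^ 1)" by (intro onorm_pos_le) (simp add: bounded_clinear_def)
  also have "\<dots> \<le> K / (cmod 2 - 1) ^ 1"
  proof -
    have "\<forall>n\<ge>1. onorm (resolvent T 2 ^^ n) \<le> K / (cmod 2 - 1) ^ n"
      using T norm_numeral[of "Num.Bit0 num.One", where 'a=complex] unfolding strongly_Kreiss_bounded_def
      by (metis one_less_numeral_iff semiring_norm(76))
    then show ?thesis by blast
  qed
  finally show ?thesis by simp
qed

lemma norm_resolvent_power_le:
  assumes "cmod l > 1" "n \<ge> 1"
  shows "norm ((resolvent T l ^^ n) x) \<le> K / (cmod l - 1) ^ n * norm x"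
proof -
  have "bounded_clinear (resolvent T l ^^ n)"
    using T assms resolvent_eqI(1)[of l T] by (intro bounded_clinear_funpow) (auto simp: strongly_Kreiss_bounded_def)
  then have "norm ((resolvent T l ^^ n) x) \<le> onorm (resolvent T l ^^ n) * norm x"
    by (intro onorm) (simp add: bounded_clinear_def)
  also have "\<dots> \<le> K / (cmod l - 1) ^ n * norm x"
    using T assms by (intro mult_right_mono) (auto simp: strongly_Kreiss_bounded_def)
  finally show ?thesis .
qed

text \<open>The series is the binomial expansion of the \<open>n\<close>-th power of the inverse of
  \<open>1 - \<zeta> T\<close>, which equals \<open>l ^ n\<close> times the \<open>n\<close>-th
  resolvent power at \<open>l = 1 / \<zeta>\<close>. Smallness of \<open>\<zeta>\<close> relative to
  \<open>b\<close> gives geometric convergence; the bound by \<open>K\<close> is the Kreiss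
  condition at \<open>l\<close>.\<close>

lemma resolvent_power_series:
  fixes \<zeta> :: complex
  defines "c \<equiv> \<lambda>n y k. (of_nat (n + k - 1 choose k) * \<zeta> ^ k) *\<^sub>C (T ^^ k) y"
  assumes b: "\<And>x. norm (T x) \<le> b * norm x" "b \<ge> 0"
    and \<zeta>: "\<zeta> \<noteq> 0" "cmod \<zeta> < 1" "4 * b * cmod \<zeta> \<le> 1"
  shows "norm (c n y k) \<le> 2 ^ n * (1/2) ^ k * norm y" (is ?bound)
    and "summable (\<lambda>k. norm (c n y k))" (is ?summable)
    and "n \<ge> 1 \<Longrightarrow> norm (\<Sum>k. c n y k) \<le> K / (1 - cmod \<zeta>) ^ n * norm y"
proof -
  show bound: "norm (c n y k) \<le> 2 ^ n * (1/2) ^ k * norm y" for n y k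
  proof -
    have pow: "norm ((T ^^ k) y) \<le> b ^ k * norm y"
    proof (induction k)
      case (Suc k)
      have "norm ((T ^^ Suc k) y) \<le> b * norm ((T ^^ k) y)" using b by simp
      also have "\<dots> \<le> b * (b ^ k * norm y)" using Suc b by (intro mult_left_mono)
      finally show ?case by (simp add: mult_ac)
    qed simp
    have ch: "real (n + k - 1 choose k) \<le> 2 ^ (n + k)"
    proof -
      have "(n + k - 1 choose k) \<le> 2 ^ (n + k - 1)" by (rule choose_le_pow2)
      also have "\<dots> \<le> 2 ^ (n + k)" by (rule power_increasing) auto
      finally show ?thesis by (metis of_nat_le_iff of_nat_numeral of_nat_power)
    qed
    have "norm (c n y k) = real (n + k - 1 choose k) * (cmod \<zeta> ^ k * norm ((T ^^ k) y))"
      by (simp add: c_def norm_scaleC norm_mult norm_power)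
    also have "\<dots> \<le> 2 ^ (n + k) * (cmod \<zeta> ^ k * (b ^ k * norm y))"
      using pow ch by (intro mult_mono) auto
    also have "\<dots> = 2 ^ n * (2 * b * cmod \<zeta>) ^ k * norm y"
      by (simp add: power_add power_mult_distrib)
    also have "\<dots> \<le> 2 ^ n * (1/2) ^ k * norm y"
      using \<zeta> b by (intro mult_left_mono mult_right_mono power_mono) auto
    finally show ?thesis .
  qed
  show summable: "summable (\<lambda>k. norm (c n y k))" for n y
    by (rule summable_comparison_test'[of "\<lambda>k. 2 ^ n * (1/2) ^ k * norm y" 0])
       (use bound in \<open>auto intro!: summable_mult summable_mult2 summable_geometric\<close>)
  define l where "l = 1 / \<zeta>"
  have l: "cmod l > 1" using \<zeta> by (simp add: l_def norm_divide)
  have res: "resolvent T l (l *\<^sub>C x - T x) = x" for x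
    using T l resolvent_eqI(2)[of l T x] by (simp add: strongly_Kreiss_bounded_def)
  have lin: "bounded_linear T" "\<And>a x. T (a *\<^sub>C x) = a *\<^sub>C T x"
    using T by (auto simp: strongly_Kreiss_bounded_def bounded_clinear_def)
  have Rc: "resolvent T l (a *\<^sub>C x) = a *\<^sub>C resolvent T l x" for a x
    using T l resolvent_eqI(1)[of l T] by (auto simp: strongly_Kreiss_bounded_def bounded_clinear_def)
  have sums: "c n y sums suminf (c n y)" for n
    using summable_norm_cancel[OF summable] by (rule summable_sums)
  \<comment> \<open>By Pascal's rule, applying \<open>1 - \<zeta> T\<close> to the series for
    \<open>Suc n\<close> gives the series for \<open>n\<close>.\<close>
  have step: "suminf (c (Suc n) y) = l *\<^sub>C resolvent T l (suminf (c n y))" for n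
  proof -
    have c0: "c n y 0 = y" for n by (simp add: c_def)
    have "(\<lambda>k. c n y (Suc k)) sums (suminf (c n y) - y)" for n
      using sums[of n] sums_Suc_iff[of "c n y" "suminf (c n y) - y"] by (simp add: c0)
    then have "(\<lambda>k. c (Suc n) y (Suc k) - c n y (Suc k)) sums ((suminf (c (Suc n) y) - y) - (suminf (c n y) - y))"
      by (intro sums_diff)
    moreover have "c (Suc n) y (Suc k) - c n y (Suc k) = \<zeta> *\<^sub>C T (c (Suc n) y k)" for k
    proof -
      have "(Suc n + Suc k - 1 choose Suc k) = (n + k choose k) + (n + k choose Suc k)" by simp
      then have "c (Suc n) y (Suc k) - c n y (Suc k) = (of_nat (n + k choose k) * \<zeta> ^ Suc k) *\<^sub>C (T ^^ Suc k) y"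
        unfolding c_def by (simp add: distrib_right scaleC_add_left)
      also have "\<dots> = \<zeta> *\<^sub>C T (c (Suc n) y k)"
        unfolding c_def lin scaleC_scaleC by (simp add: mult_ac)
      finally show ?thesis .
    qed
    ultimately have "(\<lambda>k. \<zeta> *\<^sub>C T (c (Suc n) y k)) sums (suminf (c (Suc n) y) - suminf (c n y))" by simp
    moreover have "(\<lambda>k. \<zeta> *\<^sub>C T (c (Suc n) y k)) sums (\<zeta> *\<^sub>C T (suminf (c (Suc n) y)))"
      by (intro bounded_linear.sums[OF scaleC.bounded_linear_right] bounded_linear.sums[OF lin(1)] sums)
    ultimately have "suminf (c (Suc n) y) - suminf (c n y) = \<zeta> *\<^sub>C T (suminf (c (Suc n) y))"
      by (rule sums_unique2)
    then have "l *\<^sub>C (suminf (c (Suc n) y) - suminf (c n y)) = T (suminf (c (Suc n) y))"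
      using \<zeta> by (simp add: scaleC_scaleC l_def)
    then have "l *\<^sub>C suminf (c (Suc n) y) - T (suminf (c (Suc n) y)) = l *\<^sub>C suminf (c n y)"
      by (simp add: scaleC.diff_right algebra_simps)
    then have "suminf (c (Suc n) y) = resolvent T l (l *\<^sub>C suminf (c n y))"
      using res[of "suminf (c (Suc n) y)"] by simp
    then show ?thesis by (simp add: Rc)
  qed
  have eq: "suminf (c n y) = (l ^ n) *\<^sub>C (resolvent T l ^^ n) y" for n
  proof (induction n)
    case 0
    \<comment> \<open>For \<open>n = 0\<close> truncated subtraction yields the coefficient 1 at
      \<open>k = 0\<close>, and \<open>k - 1\<close> over \<open>k\<close>, which is 0,
      afterwards.\<close>
    have "c 0 y k = (if k = 0 then y else 0)" for k by (cases k) (auto simp: c_def binomial_eq_0)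
    then have "c 0 y = (\<lambda>k. if k = 0 then y else 0)" by auto
    then show ?case using sums_unique[OF sums_single[of 0 "\<lambda>_. y"]] by simp
  next
    case (Suc n)
    then show ?case by (simp add: step Rc scaleC_scaleC)
  qed
  assume n: "n \<ge> 1"
  have "norm (suminf (c n y)) \<le> cmod l ^ n * (K / (cmod l - 1) ^ n * norm y)"
    unfolding eq norm_scaleC norm_power using norm_resolvent_power_le[OF l n]
    by (intro mult_left_mono) auto
  also have "\<dots> = K / ((cmod l - 1) / cmod l) ^ n * norm y"
    using l by (simp add: power_divide)
  also have "(cmod l - 1) / cmod l = 1 - cmod \<zeta>"
    using \<zeta> by (simp add: l_def norm_divide field_simps)
  finally show "norm (suminf (c n y)) \<le> K / (1 - cmod \<zeta>) ^ n * norm y" .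
qed


text \<open>
  The bound is \<open>K + 1\<close> instead of \<open>K\<close> because the negative binomial weights are truncated at \<open>m\<close>.
  The clause for \<open>r = 1\<close> serves to bound the norm of \<open>T\<close> in terms of \<open>K\<close> alone.
\<close>

lemma Kreiss_weights:
  assumes d: "d \<ge> 1" "8 * r \<le> d\<^sup>2"
  obtains w :: "nat \<Rightarrow> real" and m where "\<And>k. 0 \<le> w k" "\<And>k. m \<le> k \<Longrightarrow> w k = 0" "(\<Sum>k<m. w k) \<le> 1"
    "3 / 4 \<le> (\<Sum>k | r < k + d \<and> k < r + d. w k)"
    "\<And>z y. cmod z = 1 \<Longrightarrow> norm (\<Sum>k<m. (of_real (w k) * z ^ k) *\<^sub>C (T ^^ k) y) \<le> (K + 1) * norm y"
    "r = 1 \<Longrightarrow> 1 / 6 \<le> w 1"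
proof (cases "r = 0")
  case True
  define w :: "nat \<Rightarrow> real" where "w k = (if k = 0 then 1 else 0)" for k
  show ?thesis
  proof (rule that[of w 1])
    have "(\<Sum>k | r < k + d \<and> k < r + d. w k) = (\<Sum>k\<in>{0}. w k)"
      using True d by (intro sum.mono_neutral_right) (auto simp: w_def)
    then show "3 / 4 \<le> (\<Sum>k | r < k + d \<and> k < r + d. w k)" by (simp add: w_def)
    show "norm (\<Sum>k<1. (of_real (w k) * z ^ k) *\<^sub>C (T ^^ k) y) \<le> (K + 1) * norm y" for z y
      using mult_right_mono[of 1 "K + 1" "norm y"] Kreiss_constant_nonneg by (simp add: w_def)
  qed (use True in \<open>auto simp: w_def\<close>)
next
  case False
  then have r: "r \<ge> 1" by simp
  have "bounded_linear T" using Kreiss_bounded_linear[of 1] by simp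
  from bounded_linear.nonneg_bounded[OF this] obtain b where b: "b \<ge> 0" "\<And>x. norm (T x) \<le> b * norm x"
    by (auto simp: mult.commute)
  obtain n0 :: nat where n0: "4 * b * real r < real n0" using reals_Archimedean2 by blast
  \<comment> \<open>Two demands on \<open>n\<close>: it must exceed \<open>4 * b * r\<close>, so
    that the series for \<open>T\<close> converges, and it must be at least \<open>r\<close>, so
    that the variance is at most \<open>2 * r\<close>.\<close>
  define m where "m = n0 + r"
  define n where "n = Suc m"
  \<comment> \<open>This value gives the weights \<open>v\<close> the mean
    \<open>n * q / (1 - q) = r\<close>.\<close>
  define q where "q = real r / (real n + real r)"
  have q: "0 < q" "q < 1" using r by (auto simp: q_def n_def)
  have "4 * b * real r \<le> real n + real r" using n0 by (simp add: n_def m_def)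
  then have bq: "4 * b * q \<le> 1" using r by (simp add: q_def divide_le_eq)
  have q1: "1 - q = real n / (real n + real r)" using r by (simp add: q_def field_simps)
  have odds: "q / (1 - q) = real r / real n"
    unfolding q1 unfolding q_def using r by (simp add: n_def)
  define v where "v k = (1 - q) ^ n * (real (n + k - 1 choose k) * q ^ k)" for k
  have v0: "v k \<ge> 0" for k using q by (simp add: v_def)
  have v_alt: "v k = (1 - q) ^ n * (real (m + k choose k) * q ^ k)" for k by (simp add: v_def n_def)
  have q_ne: "1 - q \<noteq> 0" using q by simp
  have s0: "v sums 1"
    using sums_mult[OF negative_binomial_sums[of q m], of "(1 - q) ^ n"] q q_ne
    unfolding v_alt[abs_def] by (simp add: n_def)
  have s1: "(\<lambda>k. real k * v k) sums real r"
  proof -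
    have "(\<lambda>k. (1 - q) ^ n * (real k * (real (m + k choose k) * q ^ k))) sums ((1 - q) ^ n * (real (Suc m) * q / (1 - q) ^ (m + 2)))"
      using q by (intro sums_mult negative_binomial_mean_sums) auto
    also have "(1 - q) ^ n * (real (Suc m) * q / (1 - q) ^ (m + 2)) = real n * (q / (1 - q))"
      using q_ne by (simp add: n_def power_add power2_eq_square)
    finally show ?thesis unfolding odds v_alt by (simp add: n_def mult_ac)
  qed
  have s2: "(\<lambda>k. real k * (real k - 1) * v k) sums (real (Suc n) * (real r)\<^sup>2 / real n)"
  proof -
    have "(\<lambda>k. (1 - q) ^ n * (real k * (real k - 1) * (real (m + k choose k) * q ^ k))) sums
       ((1 - q) ^ n * (real (Suc m) * real (Suc (Suc m)) * q\<^sup>2 / (1 - q) ^ (m + 3)))"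
      using q by (intro sums_mult negative_binomial_second_moment_sums) auto
    also have "(1 - q) ^ n * (real (Suc m) * real (Suc (Suc m)) * q\<^sup>2 / (1 - q) ^ (m + 3)) = real n * real (Suc n) * (q / (1 - q))\<^sup>2"
      using q_ne by (simp add: n_def power_add power2_eq_square power3_eq_cube)
    also have "\<dots> = real (Suc n) * (real r)\<^sup>2 / real n"
      unfolding odds by (simp add: n_def power2_eq_square)
    finally show ?thesis unfolding v_alt by (simp add: mult_ac)
  qed
  have var: "(\<lambda>k. (real k - real r)\<^sup>2 * v k) sums ((real r)\<^sup>2 / real n + real r)"
  proof -
    have "(\<lambda>k. real k * (real k - 1) * v k + (1 - 2 * real r) * (real k * v k) + (real r)\<^sup>2 * v k) sums
       (real (Suc n) * (real r)\<^sup>2 / real n + (1 - 2 * real r) * real r + (real r)\<^sup>2 * 1)"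
      by (intro sums_add sums_mult s0 s1 s2)
    moreover have "real k * (real k - 1) * v k + (1 - 2 * real r) * (real k * v k) + (real r)\<^sup>2 * v k
       = (real k - real r)\<^sup>2 * v k" for k
      by (simp add: power2_eq_square algebra_simps)
    moreover have "real (Suc n) * (real r)\<^sup>2 / real n + (1 - 2 * real r) * real r + (real r)\<^sup>2 * 1 = (real r)\<^sup>2 / real n + real r"
      by (simp add: n_def field_simps power2_eq_square)
    ultimately show ?thesis by simp
  qed
  define I where "I = {k. r < k + d \<and> k < r + d}"
  have I: "finite I" by (rule finite_subset[of _ "{..<r + d}"]) (auto simp: I_def)
  \<comment> \<open>Chebyshev's inequality: the variance is at most \<open>2 * r\<close>, hence at
    most a quarter of \<open>d\<^sup>2\<close>.\<close>
  have cheb: "3 / 4 \<le> (\<Sum>k\<in>I. v k)"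
  proof -
    have d0: "real d ^ 2 > 0" using d by simp
    have "(real r)\<^sup>2 / real n \<le> real r" using r by (simp add: n_def m_def divide_le_eq power2_eq_square)
    moreover have "8 * real r \<le> real d ^ 2" using d(2) by (metis of_nat_le_iff of_nat_mult of_nat_numeral of_nat_power)
    ultimately have "((real r)\<^sup>2 / real n + real r) / real d ^ 2 \<le> (real d ^ 2 / 4) / real d ^ 2"
      by (intro divide_right_mono) (linarith, simp)
    then have V: "((real r)\<^sup>2 / real n + real r) / real d ^ 2 \<le> 1 / 4" using d by simp
    have lower: "(\<lambda>k. v k - (real k - real r)\<^sup>2 * v k / real d ^ 2) sums (1 - ((real r)\<^sup>2 / real n + real r) / real d ^ 2)"
      by (intro sums_diff s0 sums_divide var)
    have upper: "(\<lambda>k. if k \<in> I then v k else 0) sums (\<Sum>k\<in>I. v k)"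
      using sums_If_finite_set[OF I] .
    have "v k - (real k - real r)\<^sup>2 * v k / real d ^ 2 \<le> (if k \<in> I then v k else 0)" for k
    proof (cases "k \<in> I")
      case False
      then have "\<bar>real d\<bar> \<le> \<bar>real k - real r\<bar>" by (auto simp: I_def)
      then have "real d ^ 2 \<le> (real k - real r)\<^sup>2" by (simp only: abs_le_square_iff)
      then have "real d ^ 2 * v k \<le> (real k - real r)\<^sup>2 * v k" using v0 by (rule mult_right_mono)
      then show ?thesis using False d0 by (simp add: le_divide_eq mult.commute)
    qed (use v0 in simp)
    then have "1 - ((real r)\<^sup>2 / real n + real r) / real d ^ 2 \<le> (\<Sum>k\<in>I. v k)"
      using lower upper by (rule sums_le)
    with V show ?thesis by linarith
  qed
  \<comment> \<open>Truncating beyond \<open>r + d\<close> leaves the window \<open>I\<close>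
    intact, and truncating beyond \<open>n\<close> beats the factor \<open>2 ^ n\<close> in the tail
    of the series.\<close>
  define M where "M = n + r + d + 1"
  define w where "w k = (if k < M then v k else 0)" for k
  show ?thesis
  proof (rule that[of w M])
    show "0 \<le> w k" for k using v0 by (simp add: w_def)
    show "M \<le> k \<Longrightarrow> w k = 0" for k by (simp add: w_def)
    have "(\<Sum>k<M. v k) \<le> suminf v" using s0 v0 by (intro sum_le_suminf) (auto simp: sums_iff)
    then show "(\<Sum>k<M. w k) \<le> 1" using s0 by (simp add: w_def sums_iff)
    have "(\<Sum>k\<in>I. w k) = (\<Sum>k\<in>I. v k)" by (intro sum.cong) (auto simp: w_def I_def M_def)
    then show "3 / 4 \<le> (\<Sum>k | r < k + d \<and> k < r + d. w k)" using cheb by (simp add: I_def)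
    \<comment> \<open>Here \<open>v 1\<close> is the reciprocal of
      \<open>(1 + 1/n) ^ (n + 1)\<close>, and \<open>(1 + 1/n) ^ n\<close> is at most
      \<open>exp 1\<close>, hence at most 3.\<close>
    show "1 / 6 \<le> w 1" if "r = 1"
    proof -
      have "(1 + 1 / real n) ^ n \<le> exp (1 / real n) ^ n" by (intro power_mono exp_ge_add_one_self) auto
      also have "\<dots> = exp (real n * (1 / real n))" by (rule exp_of_nat_mult[symmetric])
      also have "\<dots> = exp 1" by (simp add: n_def del: of_nat_Suc)
      also have "\<dots> \<le> 3" by (rule exp_le)
      finally have "(1 + 1 / real n) ^ n * (1 + 1 / real n) \<le> 3 * 2" by (intro mult_mono) (auto simp: n_def)
      moreover have "v 1 = 1 / ((1 + 1 / real n) ^ n * (1 + 1 / real n))"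
      proof -
        have a: "1 - q = 1 / (1 + 1 / real n)" unfolding q1 that by (simp add: n_def field_simps)
        have b: "real n * q = 1 / (1 + 1 / real n)" unfolding q_def that by (simp add: n_def field_simps)
        have "v 1 = (1 - q) ^ n * (real n * q)" by (simp add: v_def)
        then show ?thesis unfolding a b by (simp add: power_one_over)
      qed
      moreover have "0 < (1 + 1 / real n) ^ n * (1 + 1 / real n)" by (intro mult_pos_pos zero_less_power) (auto simp: add_pos_nonneg)
      ultimately have "1 / (3 * 2) \<le> v 1" by (simp only: divide_left_mono zero_le_one mult_pos_pos)
      then show ?thesis using d by (simp add: w_def M_def)
    qed
    fix z :: complex and y :: 'a
    assume z: "cmod z = 1"
    define c where "c k = (of_nat (n + k - 1 choose k) * (of_real q * z) ^ k) *\<^sub>C (T ^^ k) y" for k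
    have \<zeta>: "of_real q * z \<noteq> 0" "cmod (of_real q * z) < 1" "4 * b * cmod (of_real q * z) \<le> 1" "cmod (of_real q * z) = q"
      using q z bq by (auto simp: norm_mult)
    note ser = resolvent_power_series[OF b(2,1) \<zeta>(1-3), where n = n and y = y, folded c_def]
    have sc: "summable c" using ser(2) by (rule summable_norm_cancel)
    have tail: "norm (\<Sum>k. c (k + M)) \<le> norm y"
    proof -
      have g: "(\<lambda>k. 2 ^ n * (1/2) ^ M * norm y * (1/2) ^ k) sums (2 ^ n * (1/2) ^ M * norm y * (1 / (1 - 1/2)))"
        by (intro sums_mult geometric_sums) auto
      have "norm (\<Sum>k. c (k + M)) \<le> (\<Sum>k. norm (c (k + M)))"
        using ser(2) by (intro summable_norm) (simp add: summable_iff_shift[of "\<lambda>k. norm (c k)"])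
      also have "\<dots> \<le> (\<Sum>k. 2 ^ n * (1/2) ^ M * norm y * (1/2) ^ k)"
      proof (rule suminf_le)
        show "norm (c (k + M)) \<le> 2 ^ n * (1/2) ^ M * norm y * (1/2) ^ k" for k
          using ser(1)[of "k + M"] by (simp add: power_add mult_ac)
      qed (use ser(2) g in \<open>auto simp: summable_iff_shift[of "\<lambda>k. norm (c k)"] sums_iff\<close>)
      also have "\<dots> = 2 ^ n * (1/2) ^ M * norm y * 2" using g by (simp add: sums_iff)
      also have "\<dots> = (1/2) ^ (r + d) * norm y" by (simp add: M_def power_add power_one_over)
      also have "\<dots> \<le> 1 * norm y" by (intro mult_right_mono power_le_one) auto
      finally show ?thesis by simp
    qed
    have "(\<Sum>k<M. (of_real (w k) * z ^ k) *\<^sub>C (T ^^ k) y) = of_real ((1 - q) ^ n) *\<^sub>C (\<Sum>k<M. c k)"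
      unfolding scaleC.sum_right c_def scaleC_scaleC
      by (intro sum.cong refl) (simp add: w_def v_def power_mult_distrib mult_ac)
    also have "(\<Sum>k<M. c k) = suminf c - (\<Sum>k. c (k + M))"
      using suminf_split_initial_segment[OF sc, of M] by simp
    finally have "norm (\<Sum>k<M. (of_real (w k) * z ^ k) *\<^sub>C (T ^^ k) y) = (1 - q) ^ n * norm (suminf c - (\<Sum>k. c (k + M)))"
      using q by (simp add: norm_scaleC power_abs del: of_real_power of_real_diff)
    also have "\<dots> \<le> (1 - q) ^ n * (norm (suminf c) + norm (\<Sum>k. c (k + M)))"
      using q by (intro mult_left_mono norm_triangle_ineq4) auto
    also have "\<dots> \<le> (1 - q) ^ n * norm (suminf c) + 1 * norm y"
      using q tail unfolding distrib_left by (intro add_left_mono mult_mono power_le_one) auto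
    \<comment> \<open>The normalising factor of the weights cancels the denominator of the Kreiss
      bound exactly.\<close>
    also have "\<dots> \<le> (1 - q) ^ n * (K / (1 - q) ^ n * norm y) + 1 * norm y"
      using ser(3) q unfolding \<zeta>(4) by (intro add_right_mono mult_left_mono) (auto simp: n_def)
    also have "\<dots> = (K + 1) * norm y" using q_ne by (simp add: distrib_right)
    finally show "norm (\<Sum>k<M. (of_real (w k) * z ^ k) *\<^sub>C (T ^^ k) y) \<le> (K + 1) * norm y" .
  qed
qed

end

section \<open>Growth of the powers\<close>

lemma trig_poly_nat:
  "trig_poly {0..<int m} y t = (\<Sum>k<m. cis (2 * pi * t) ^ k *\<^sub>C y (int k))"
proof -
  have "{0..<int m} = int ` {..<m}" by (simp add: lessThan_atLeast0 image_int_atLeastLessThan)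
  then show ?thesis
    unfolding trig_poly_def by (simp add: sum.reindex Complex.DeMoivre mult_ac)
qed

context riesz_bounded
begin

text \<open>A single frequency is a block of length one, and the norm of its term is constant in
  \<open>t\<close>.\<close>

lemma norm_coeff_le:
  fixes y :: "int \<Rightarrow> 'a"
  assumes "finite S" "k \<in> S"
  shows "norm (y k) \<le> 2 * B\<^sup>2 * Lp_norm p (trig_poly S y)"
proof -
  have "{k..<k + 1} = {k}" by auto
  then have "Lp_norm p (trig_poly {k..<k + 1} y) = Lp_norm p (\<lambda>_. y k)"
    by (intro Lp_norm_cong) (simp add: trig_poly_def norm_scaleC)
  then show ?thesis
    using Lp_norm_trig_poly_interval[of S k "k + 1" y] assms \<open>{k..<k + 1} = {k}\<close>
    by (simp add: Lp_norm_const[OF p_pos])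
qed

text \<open>A bound for \<open>T\<close> that depends only on \<open>B\<close> and \<open>K\<close>,
  needed because the final constant must be uniform in \<open>T\<close>. It reads off the
  coefficient of \<open>T x\<close>, which carries weight at least 1/6, from the averaged sum for
  \<open>r = 1\<close> (with \<open>d = 3\<close>, as 8 is at most 9).\<close>

lemma Kreiss_norm_le:
  fixes T :: "'a \<Rightarrow> 'a"
  assumes T: "strongly_Kreiss_bounded K T"
  shows "norm (T x) \<le> 12 * B\<^sup>2 * (K + 1) * norm x"
proof -
  obtain w m where w: "\<And>k. m \<le> k \<Longrightarrow> w k = 0" "1 / 6 \<le> w 1"
    "\<And>z y. cmod z = 1 \<Longrightarrow> norm (\<Sum>k<m. (of_real (w k) * z ^ k) *\<^sub>C (T ^^ k) y) \<le> (K + 1) * norm y"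
    by (rule Kreiss_weights[OF T, of 3 1]) auto
  define y where "y l = complex_of_real (w (nat l)) *\<^sub>C (T ^^ nat l) x" for l
  have "m > 1" using w(1)[of 1] w(2) by (cases "m \<le> 1") auto
  have "trig_poly {0..<int m} y t = (\<Sum>k<m. (of_real (w k) * cis (2 * pi * t) ^ k) *\<^sub>C (T ^^ k) x)" for t
    by (simp add: trig_poly_nat y_def scaleC_scaleC mult.commute)
  then have "Lp_norm p (trig_poly {0..<int m} y) \<le> (K + 1) * Lp_norm p (\<lambda>_. x)"
    using w(3)[of "cis _" x] Kreiss_constant_nonneg[OF T] p_pos
    by (intro Lp_norm_mono continuous_on_trig_poly continuous_on_const) simp_all
  then have "2 * B\<^sup>2 * Lp_norm p (trig_poly {0..<int m} y) \<le> 2 * B\<^sup>2 * ((K + 1) * norm x)"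
    by (intro mult_left_mono) (auto simp: Lp_norm_const[OF p_pos])
  moreover have "norm (y 1) \<le> 2 * B\<^sup>2 * Lp_norm p (trig_poly {0..<int m} y)"
    using \<open>m > 1\<close> by (intro norm_coeff_le) auto
  moreover have "1 / 6 * norm (T x) \<le> norm (y 1)"
    unfolding y_def norm_scaleC using w(2) by (intro mult_mono) auto
  ultimately show ?thesis by (simp add: field_simps)
qed

text \<open>Applying the weighted average of powers, centred at \<open>r = l0 - 3 * W\<close>, to
  the initial sum of length \<open>V\<close> gives a polynomial whose coefficients are
  \<open>b l\<close> times \<open>T\<close> to the power \<open>l\<close> applied to
  \<open>x\<close>. On the window \<open>b\<close> is bounded below and of bounded variation, so it
  can be divided out. For small \<open>l0\<close> the window lies inside the initial sum and a cut
  is enough.\<close>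

lemma Kreiss_window:
  fixes T :: "'a \<Rightarrow> 'a"
  assumes T: "strongly_Kreiss_bounded K T" and W: "l0 \<le> W\<^sup>2" "8 * W \<le> V" "W > 0"
  shows "Lp_norm p (trig_poly {int l0..<int l0 + int W} (\<lambda>l. (T ^^ nat l) x))
    \<le> 10 * B\<^sup>2 * (K + 1) * Lp_norm p (trig_poly {0..<int V} (\<lambda>l. (T ^^ nat l) x))"
proof (cases "l0 < 3 * W")
  case True
  let ?g = "trig_poly {0..<int V} (\<lambda>l. (T ^^ nat l) x)"
  have "Lp_norm p (trig_poly {int l0..<int l0 + int W} (\<lambda>l. (T ^^ nat l) x)) \<le> 2 * B\<^sup>2 * Lp_norm p ?g"
    using True W by (intro Lp_norm_trig_poly_interval) auto
  also have "\<dots> \<le> 10 * B\<^sup>2 * (K + 1) * Lp_norm p ?g"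
  proof (rule mult_right_mono)
    show "2 * B\<^sup>2 \<le> 10 * B\<^sup>2 * (K + 1)"
      using mult_left_mono[of 2 "10 * (K + 1)" "B\<^sup>2"] Kreiss_constant_nonneg[OF T] by (simp add: algebra_simps)
  qed (rule Lp_norm_nonneg)
  finally show ?thesis .
next
  case False
  define r where "r = l0 - 3 * W"
  define d where "d = 3 * W"
  have l0: "l0 = r + d" using False by (simp add: r_def d_def)
  \<comment> \<open>\<open>8 * r\<close> is at most \<open>8 * W\<^sup>2\<close>, while
    \<open>d\<^sup>2\<close> is \<open>9 * W\<^sup>2\<close>.\<close>
  have rd: "8 * r \<le> d\<^sup>2" using W unfolding r_def d_def by (simp add: power_mult_distrib)
  have d1: "d \<ge> 1" using W by (simp add: d_def)
  obtain w m where w0: "\<And>k. 0 \<le> w k" and wm: "\<And>k. m \<le> k \<Longrightarrow> w k = 0" and w1: "(\<Sum>k<m. w k) \<le> 1"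
    and wI: "3 / 4 \<le> (\<Sum>k | r < k + d \<and> k < r + d. w k)"
    and wn: "\<And>z y. cmod z = 1 \<Longrightarrow> norm (\<Sum>k<m. (of_real (w k) * z ^ k) *\<^sub>C (T ^^ k) y) \<le> (K + 1) * norm y"
    by (rule Kreiss_weights[OF T d1 rd]) blast
  define PP where "PP i = (\<Sum>k<i. w k)" for i
  \<comment> \<open>The total weight of the \<open>k\<close> for which \<open>l - k\<close> is an
    exponent of the initial sum; truncated subtraction covers \<open>l < V\<close>.\<close>
  define b where "b l = PP (l + 1) - PP (l + 1 - V)" for l
  define g where "g = trig_poly {0..<int V} (\<lambda>l. (T ^^ nat l) x)"
  define L where "L = m + V + l0 + W"
  define y where "y l = b (nat l) *\<^sub>R (T ^^ nat l) x" for l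
  have PP_mono: "PP i \<le> PP j" if "i \<le> j" for i j
    unfolding PP_def using that w0 by (intro sum_mono2) auto
  have PP_0: "0 \<le> PP i" for i unfolding PP_def using w0 by (simp add: sum_nonneg)
  have PP_1: "PP i \<le> 1" for i
  proof -
    have "PP i \<le> PP (max i m)" by (rule PP_mono) simp
    also have "PP (max i m) = PP m" unfolding PP_def by (rule sum.mono_neutral_right) (auto simp: wm)
    finally show ?thesis using w1 by (simp add: PP_def)
  qed
  have b_sum: "b l = (\<Sum>k=l+1-V..<l+1. w k)" for l
    using sum.atLeastLessThan_concat[of 0 "l + 1 - V" "l + 1" w] by (simp add: b_def PP_def lessThan_atLeast0)
  \<comment> \<open>Since \<open>V \<ge> 8 * W\<close>, the range of summation of \<open>b l\<close>
    contains the whole region where the weights concentrate. The right end \<open>l0 + W\<close> is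
    included because Abel summation needs a boundary weight.\<close>
  have b_ge: "3 / 4 \<le> b l" if "l0 \<le> l" "l \<le> l0 + W" for l
  proof -
    have "(\<Sum>k | r < k + d \<and> k < r + d. w k) \<le> b l"
      unfolding b_sum using that W w0 by (intro sum_mono2) (auto simp: l0 d_def)
    with wI show ?thesis by simp
  qed
  have h: "trig_poly {0..<int L} y t = (\<Sum>k<m. (of_real (w k) * cis (2 * pi * t) ^ k) *\<^sub>C (T ^^ k) (g t))" for t
  proof -
    define Z where "Z l = cis (2 * pi * t) ^ l *\<^sub>C (T ^^ l) x" for l
    have "(of_real (w k) * cis (2 * pi * t) ^ k) *\<^sub>C (T ^^ k) (g t) = (\<Sum>l | l \<in> {..<L} \<and> k \<le> l \<and> l < k + V. w k *\<^sub>R Z l)"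
      if k: "k < m" for k
    proof -
      have "(of_real (w k) * cis (2 * pi * t) ^ k) *\<^sub>C (T ^^ k) (g t) = (\<Sum>j<V. w k *\<^sub>R Z (j + k))"
      proof -
        have "(of_real (w k) * cis (2 * pi * t) ^ k) *\<^sub>C (T ^^ k) (cis (2 * pi * t) ^ j *\<^sub>C (T ^^ j) x) = w k *\<^sub>R Z (j + k)" for j
        proof -
          have "(T ^^ (j + k)) x = (T ^^ k) ((T ^^ j) x)" by (subst add.commute) (simp add: funpow_add)
          then show ?thesis
            unfolding Z_def Kreiss_scaleC[OF T] scaleC_scaleC scaleR_scaleC power_add by (simp only: mult_ac)
        qed
        moreover have "(T ^^ k) (g t) = (\<Sum>j<V. (T ^^ k) (cis (2 * pi * t) ^ j *\<^sub>C (T ^^ j) x))"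
          using bounded_linear.linear[OF Kreiss_bounded_linear[OF T, of k]] by (simp add: g_def trig_poly_nat linear_sum)
        ultimately show ?thesis by (simp only: scaleC.sum_right)
      qed
      also have "\<dots> = (\<Sum>l=0+k..<V+k. w k *\<^sub>R Z l)"
        unfolding sum.shift_bounds_nat_ivl by (simp add: lessThan_atLeast0)
      also have "{0+k..<V+k} = {l. l \<in> {..<L} \<and> k \<le> l \<and> l < k + V}" using k by (auto simp: L_def)
      finally show ?thesis .
    qed
    then have "(\<Sum>k<m. (of_real (w k) * cis (2 * pi * t) ^ k) *\<^sub>C (T ^^ k) (g t))
       = (\<Sum>k<m. \<Sum>l | l \<in> {..<L} \<and> k \<le> l \<and> l < k + V. w k *\<^sub>R Z l)" by simp
    also have "\<dots> = (\<Sum>l<L. \<Sum>k | k \<in> {..<m} \<and> k \<le> l \<and> l < k + V. w k *\<^sub>R Z l)"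
      by (rule sum.swap_restrict) auto
    also have "\<dots> = (\<Sum>l<L. b l *\<^sub>R Z l)"
    proof (rule sum.cong[OF refl])
      fix l
      have "(\<Sum>k | k \<in> {..<m} \<and> k \<le> l \<and> l < k + V. w k) = b l"
        unfolding b_sum by (rule sum.mono_neutral_left) (auto intro: wm leI)
      then show "(\<Sum>k | k \<in> {..<m} \<and> k \<le> l \<and> l < k + V. w k *\<^sub>R Z l) = b l *\<^sub>R Z l"
        by (simp flip: scaleR_left.sum)
    qed
    also have "\<dots> = trig_poly {0..<int L} y t"
      by (simp add: trig_poly_nat y_def Z_def scaleC.scaleR_right)
    finally show ?thesis by simp
  qed
  define M where "M = 2 * B\<^sup>2 * ((K + 1) * Lp_norm p g)"
  have M0: "M \<ge> 0" using Kreiss_constant_nonneg[OF T] by (simp add: M_def Lp_norm_nonneg)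
  have "Lp_norm p (trig_poly {0..<int L} y) \<le> (K + 1) * Lp_norm p g"
  proof (rule Lp_norm_mono)
    show "norm (trig_poly {0..<int L} y t) \<le> (K + 1) * norm (g t)" for t
      unfolding h by (rule wn) simp
  qed (use Kreiss_constant_nonneg[OF T] p_pos in \<open>auto simp: g_def intro!: continuous_intros\<close>)
  then have LM: "2 * B\<^sup>2 * Lp_norm p (trig_poly {0..<int L} y) \<le> M"
    unfolding M_def by (intro mult_left_mono) auto
  define \<mu> where "\<mu> i = 1 / b (l0 + i)" for i
  have "Lp_norm p (trig_poly {int l0..<int l0 + int i} y) \<le> M" if "i \<le> W" for i
    using order_trans[OF Lp_norm_trig_poly_interval LM, of "int l0" "int l0 + int i"] that by (auto simp: L_def)
  then have "Lp_norm p (trig_poly {int l0..<int l0 + int W} (\<lambda>l. \<mu> (nat (l - int l0)) *\<^sub>R y l))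
      \<le> (\<bar>\<mu> W\<bar> + (\<Sum>i<W. \<bar>\<mu> i - \<mu> (Suc i)\<bar>)) * M"
    by (rule Lp_norm_trig_poly_multiplier)
  also have "trig_poly {int l0..<int l0 + int W} (\<lambda>l. \<mu> (nat (l - int l0)) *\<^sub>R y l)
      = trig_poly {int l0..<int l0 + int W} (\<lambda>l. (T ^^ nat l) x)"
  proof -
    have "\<mu> (nat (l - int l0)) *\<^sub>R y l = (T ^^ nat l) x" if l: "l \<in> {int l0..<int l0 + int W}" for l
    proof -
      have "l0 + nat (l - int l0) = nat l" using l by auto
      moreover have "3 / 4 \<le> b (nat l)" using l by (intro b_ge) auto
      ultimately show ?thesis by (simp add: \<mu>_def y_def)
    qed
    then show ?thesis by (simp add: trig_poly_def fun_eq_iff)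
  qed
  also have "(\<bar>\<mu> W\<bar> + (\<Sum>i<W. \<bar>\<mu> i - \<mu> (Suc i)\<bar>)) * M \<le> 5 * M"
  proof (rule mult_right_mono[OF _ M0])
    \<comment> \<open>\<open>b\<close> is a difference of two increasing sequences in the unit
      interval, so its variation is at most 2. Passing to reciprocals costs 16/9, and with the
      boundary term 4/3 the total is 44/9.\<close>
    define P1 where "P1 i = PP (l0 + i + 1)" for i
    define P2 where "P2 i = PP (l0 + i + 1 - V)" for i
    have "\<bar>\<mu> i - \<mu> (Suc i)\<bar> \<le> 16 / 9 * ((P1 (Suc i) - P1 i) + (P2 (Suc i) - P2 i))" if i: "i < W" for i
    proof -
      have b1: "3 / 4 \<le> b (l0 + i)" and b2: "3 / 4 \<le> b (l0 + Suc i)" using i by (intro b_ge; simp)+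
      have "\<bar>\<mu> i - \<mu> (Suc i)\<bar> = \<bar>b (l0 + Suc i) - b (l0 + i)\<bar> / (b (l0 + i) * b (l0 + Suc i))"
      proof -
        have "\<mu> i - \<mu> (Suc i) = (b (l0 + Suc i) - b (l0 + i)) / (b (l0 + i) * b (l0 + Suc i))"
          unfolding \<mu>_def using b1 b2 by (subst diff_frac_eq) auto
        moreover have "0 < b (l0 + i) * b (l0 + Suc i)" using b1 b2 by (intro mult_pos_pos) auto
        ultimately show ?thesis by (simp add: abs_divide)
      qed
      also have "\<dots> \<le> \<bar>b (l0 + Suc i) - b (l0 + i)\<bar> / (3/4 * (3/4))"
        using b1 b2 by (intro divide_left_mono mult_mono mult_pos_pos) auto
      also have "\<bar>b (l0 + Suc i) - b (l0 + i)\<bar> \<le> (P1 (Suc i) - P1 i) + (P2 (Suc i) - P2 i)"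
      proof -
        have "b (l0 + i) = P1 i - P2 i" "b (l0 + Suc i) = P1 (Suc i) - P2 (Suc i)"
          by (simp_all add: b_def P1_def P2_def)
        moreover have "P1 i \<le> P1 (Suc i)" "P2 i \<le> P2 (Suc i)" unfolding P1_def P2_def by (auto intro: PP_mono)
        ultimately show ?thesis by linarith
      qed
      finally show ?thesis by (simp add: divide_right_mono)
    qed
    then have "(\<Sum>i<W. \<bar>\<mu> i - \<mu> (Suc i)\<bar>) \<le> (\<Sum>i<W. 16 / 9 * ((P1 (Suc i) - P1 i) + (P2 (Suc i) - P2 i)))"
      by (intro sum_mono) auto
    also have "\<dots> = 16 / 9 * ((P1 W - P1 0) + (P2 W - P2 0))"
      unfolding sum_distrib_left[symmetric] sum.distrib sum_lessThan_telescope ..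
    also have "\<dots> \<le> 16 / 9 * 2"
    proof -
      have "P1 W \<le> 1" "P2 W \<le> 1" "0 \<le> P1 0" "0 \<le> P2 0" unfolding P1_def P2_def by (auto intro: PP_1 PP_0)
      then show ?thesis by simp
    qed
    finally have "(\<Sum>i<W. \<bar>\<mu> i - \<mu> (Suc i)\<bar>) \<le> 32 / 9" by simp
    moreover have "\<bar>\<mu> W\<bar> \<le> 4 / 3"
      using b_ge[of "l0 + W"] by (simp add: \<mu>_def abs_if field_simps)
    ultimately show "\<bar>\<mu> W\<bar> + (\<Sum>i<W. \<bar>\<mu> i - \<mu> (Suc i)\<bar>) \<le> 5" by simp
  qed
  finally show ?thesis by (simp add: M_def g_def mult_ac)
qed

end

context block_bounded
begin

text \<open>Cut the sum into \<open>N ^ a\<close> windows of length \<open>N ^ b\<close>. As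
  \<open>a \<le> b\<close>, every window starts below the square of its length, so
  \<open>Kreiss_window\<close> applies with \<open>V = N ^ Suc b\<close>, and the windows are joined
  with a factor \<open>N / 2\<close> per level.\<close>

lemma Kreiss_partial_sum_step:
  fixes T :: "'a \<Rightarrow> 'a"
  assumes T: "strongly_Kreiss_bounded K T" and ab: "a \<le> b"
    and D: "Lp_norm p (trig_poly {0..<int (N ^ Suc b)} (\<lambda>l. (T ^^ nat l) x)) \<le> D"
  shows "Lp_norm p (trig_poly {0..<int (N ^ (a + b))} (\<lambda>l. (T ^^ nat l) x))
    \<le> (real N / 2) ^ a * (10 * B\<^sup>2 * (K + 1) * D)"
proof -
  have "Lp_norm p (trig_poly {0..<0 + int (N ^ a * N ^ b)} (\<lambda>l. (T ^^ nat l) x))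
    \<le> (real N / 2) ^ a * (10 * B\<^sup>2 * (K + 1) * D)"
  proof (rule Lp_norm_trig_poly_blocks)
    fix j assume j: "j < N ^ a"
    have "j * N ^ b \<le> N ^ b * N ^ b"
      using j ab N_ge_8 by (intro mult_right_mono order_trans[OF less_imp_le[OF j]] power_increasing) auto
    moreover have "8 * N ^ b \<le> N ^ Suc b" using N_ge_8 by simp
    moreover have "N ^ b > 0" using N_ge_8 by simp
    ultimately have "Lp_norm p (trig_poly {int (j * N ^ b)..<int (j * N ^ b) + int (N ^ b)} (\<lambda>l. (T ^^ nat l) x))
      \<le> 10 * B\<^sup>2 * (K + 1) * Lp_norm p (trig_poly {0..<int (N ^ Suc b)} (\<lambda>l. (T ^^ nat l) x))"
      by (intro Kreiss_window[OF T]) (auto simp: power2_eq_square)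
    also have "\<dots> \<le> 10 * B\<^sup>2 * (K + 1) * D"
      using D Kreiss_constant_nonneg[OF T] by (intro mult_left_mono) auto
    finally show "Lp_norm p (trig_poly {0 + int (j * N ^ b)..<0 + int (Suc j * N ^ b)} (\<lambda>l. (T ^^ nat l) x))
      \<le> 10 * B\<^sup>2 * (K + 1) * D" by (simp add: add.commute)
  qed
  then show ?thesis by (simp add: power_add)
qed

text \<open>Strong induction, halving \<open>n\<close>. The base 3/4 lies above the block factor
  1/2, and the surplus \<open>(3 / 2) ^ a\<close> absorbs the constant lost in each step.
  \<open>A\<close> is chosen before \<open>T\<close>.\<close>

lemma Kreiss_partial_sum_growth:
  obtains A where "A \<ge> 0" "\<And>T :: 'a \<Rightarrow> 'a. \<And>x n. strongly_Kreiss_bounded K T \<Longrightarrow>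
    Lp_norm p (trig_poly {0..<int (N ^ n)} (\<lambda>l. (T ^^ nat l) x)) \<le> A * (3 / 4 * real N) ^ n * norm x"
proof -
  define C where "C = 10 * B\<^sup>2 * (K + 1)"
  define \<rho> where "\<rho> = 3 / 4 * real N"
  have \<rho>: "\<rho> \<ge> 1" using N_ge_8 by (simp add: \<rho>_def)
  obtain a0 where a0: "C * \<rho> < (3 / 2) ^ a0" using real_arch_pow[of "3/2" "C * \<rho>"] by auto
  \<comment> \<open>From this size on, half of \<open>n\<close> is at least \<open>a0\<close> and at
    least 2, so that \<open>Suc b < n\<close> in the induction step.\<close>
  define n0 where "n0 = 2 * a0 + 4"
  define \<tau> where "\<tau> = max 1 (12 * B\<^sup>2 * (K + 1))"
  define A where "A = real (N ^ n0) * \<tau> ^ (N ^ n0)"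
  have A0: "A \<ge> 0" by (simp add: A_def \<tau>_def)
  have "Lp_norm p (trig_poly {0..<int (N ^ n)} (\<lambda>l. (T ^^ nat l) x)) \<le> A * \<rho> ^ n * norm x"
    if T: "strongly_Kreiss_bounded K T" for T :: "'a \<Rightarrow> 'a" and x n
  proof (induction n rule: less_induct)
    case (less n)
    show ?case
    proof (cases "n < n0")
      case True
      have pow: "norm ((T ^^ l) x) \<le> \<tau> ^ l * norm x" for l
      proof (induction l)
        case (Suc l)
        have "norm ((T ^^ Suc l) x) \<le> 12 * B\<^sup>2 * (K + 1) * norm ((T ^^ l) x)"
          using Kreiss_norm_le[OF T] by simp
        also have "\<dots> \<le> \<tau> * (\<tau> ^ l * norm x)"
          using Suc by (intro mult_mono) (auto simp: \<tau>_def)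
        finally show ?case by (simp add: mult_ac)
      qed simp
      have Nn: "N ^ n \<le> N ^ n0" using True N_ge_8 by (intro power_increasing) auto
      have "norm (trig_poly {0..<int (N ^ n)} (\<lambda>l. (T ^^ nat l) x) t) \<le> A * norm x" for t
      proof -
        have "norm (trig_poly {0..<int (N ^ n)} (\<lambda>l. (T ^^ nat l) x) t) \<le> (\<Sum>l<N ^ n. \<tau> ^ (N ^ n0) * norm x)"
          unfolding trig_poly_nat
        proof (intro sum_norm_le)
          fix l assume l: "l \<in> {..<N ^ n}"
          have "\<tau> ^ l * norm x \<le> \<tau> ^ (N ^ n0) * norm x"
            using l Nn by (intro mult_right_mono power_increasing) (auto simp: \<tau>_def)
          then show "norm (cis (2 * pi * t) ^ l *\<^sub>C (T ^^ nat (int l)) x) \<le> \<tau> ^ (N ^ n0) * norm x"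
            using order_trans[OF pow[of l]] by (simp add: norm_scaleC norm_power)
        qed
        also have "\<dots> = real (N ^ n) * (\<tau> ^ (N ^ n0) * norm x)" by simp
        also have "\<dots> \<le> real (N ^ n0) * (\<tau> ^ (N ^ n0) * norm x)"
          using Nn by (intro mult_right_mono) (auto simp: \<tau>_def simp del: of_nat_power)
        finally show ?thesis by (simp add: A_def)
      qed
      then have "Lp_norm p (trig_poly {0..<int (N ^ n)} (\<lambda>l. (T ^^ nat l) x)) \<le> A * Lp_norm p (\<lambda>_. x)"
        using A0 p_pos by (intro Lp_norm_mono) (auto intro!: continuous_intros)
      also have "\<dots> = A * 1 * norm x" by (simp add: Lp_norm_const[OF p_pos])
      also have "\<dots> \<le> A * \<rho> ^ n * norm x"
        using A0 \<rho> by (intro mult_right_mono mult_left_mono one_le_power) auto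
      finally show ?thesis .
    next
      case False
      define a where "a = n div 2"
      define b where "b = n - a"
      have ab: "a \<le> b" "n = a + b" "Suc b < n" "a0 \<le> a" using False by (auto simp: a_def b_def n0_def)
      have "Lp_norm p (trig_poly {0..<int (N ^ n)} (\<lambda>l. (T ^^ nat l) x))
          \<le> (real N / 2) ^ a * (C * (A * \<rho> ^ Suc b * norm x))"
        unfolding C_def ab(2) by (rule Kreiss_partial_sum_step[OF T ab(1)]) (rule less.IH[OF ab(3)])
      also have "\<dots> = (C * \<rho>) * ((real N / 2) ^ a * A * \<rho> ^ b * norm x)" by simp
      also have "\<dots> \<le> (3 / 2) ^ a * ((real N / 2) ^ a * A * \<rho> ^ b * norm x)"
      proof (rule mult_right_mono)
        have "(3 / 2 :: real) ^ a0 \<le> (3 / 2) ^ a" using ab(4) by (intro power_increasing) auto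
        with a0 show "C * \<rho> \<le> (3 / 2) ^ a" by linarith
      qed (use A0 \<rho> in auto)
      also have "\<dots> = A * (((3 / 2) * (real N / 2)) ^ a * \<rho> ^ b) * norm x"
        by (simp only: power_mult_distrib mult_ac)
      also have "(3 / 2) * (real N / 2) = \<rho>" by (simp add: \<rho>_def)
      finally show ?thesis by (simp only: ab(2) power_add)
    qed
  qed
  with A0 show ?thesis unfolding \<rho>_def by (rule that)
qed

lemma Kreiss_power_growth:
  fixes K :: real
  defines "\<alpha> \<equiv> ln (3 / 4 * real N) / (2 * ln (real N))"
  obtains C where "\<And>T :: 'a \<Rightarrow> 'a. \<And>n. strongly_Kreiss_bounded K T \<Longrightarrow> n \<ge> 1 \<Longrightarrow>
    onorm (T ^^ n) \<le> C * real n powr \<alpha>"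
proof -
  define \<rho> where "\<rho> = 3 / 4 * real N"
  have \<rho>: "\<rho> \<ge> 1" using N_ge_8 by (simp add: \<rho>_def)
  have \<alpha>0: "\<alpha> \<ge> 0" using N_ge_8 \<rho> by (simp add: \<alpha>_def \<rho>_def)
  obtain A where A0: "A \<ge> 0" and A: "\<And>T :: 'a \<Rightarrow> 'a. \<And>x n. strongly_Kreiss_bounded K T \<Longrightarrow>
    Lp_norm p (trig_poly {0..<int (N ^ n)} (\<lambda>l. (T ^^ nat l) x)) \<le> A * \<rho> ^ n * norm x"
    using Kreiss_partial_sum_growth unfolding \<rho>_def by blast
  define C where "C = 2 * B\<^sup>2 * (10 * B\<^sup>2 * (K + 1)) * A * \<rho>\<^sup>2"
  have "onorm (T ^^ n) \<le> C * real n powr \<alpha>" if T: "strongly_Kreiss_bounded K T" and n: "n \<ge> 1" for T :: "'a \<Rightarrow> 'a" and n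
  proof -
    have K0: "K \<ge> 0" by (rule Kreiss_constant_nonneg[OF T])
    have "\<exists>a. n \<le> N ^ (2 * a)"
    proof
      have "n < 2 ^ n" by (rule less_exp)
      also have "(2::nat) ^ n \<le> N ^ (2 * n)"
        using N_ge_8 by (intro order_trans[OF power_mono[of 2 N n] power_increasing]) auto
      finally show "n \<le> N ^ (2 * n)" by simp
    qed
    then obtain a where a: "n \<le> N ^ (2 * a)" and least: "\<And>a'. a' < a \<Longrightarrow> \<not> n \<le> N ^ (2 * a')"
      using exists_least_iff[of "\<lambda>a. n \<le> N ^ (2 * a)"] by blast
    \<comment> \<open>\<open>\<alpha>\<close> is the exponent with
      \<open>N powr (2 * \<alpha>) = \<rho>\<close>. Minimality of \<open>a\<close> bounds
      \<open>N ^ (2 * (a - 1))\<close> by \<open>n\<close>, and the extra factor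
      \<open>\<rho>\<close> pays for the last level.\<close>
    have \<rho>a: "\<rho> ^ a \<le> \<rho> * real n powr \<alpha>"
    proof (cases a)
      case 0
      have "1 * 1 \<le> \<rho> * real n powr \<alpha>" using \<rho> \<alpha>0 n by (intro mult_mono ge_one_powr_ge_zero) auto
      then show ?thesis using 0 by simp
    next
      case (Suc a')
      have "real N ^ (2 * a') \<le> real n" using least[of a'] Suc by (metis lessI less_imp_le linorder_not_le of_nat_le_iff of_nat_power)
      then have "(real N ^ (2 * a')) powr \<alpha> \<le> real n powr \<alpha>" using \<alpha>0 by (intro powr_mono2) auto
      moreover have "(real N ^ (2 * a')) powr \<alpha> = \<rho> ^ a'"
      proof -
        have "(real N ^ (2 * a')) powr \<alpha> = exp (\<alpha> * (real (2 * a') * ln (real N)))"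
          using N_ge_8 by (simp add: powr_def ln_realpow)
        also have "\<alpha> * (real (2 * a') * ln (real N)) = real a' * ln \<rho>"
          using N_ge_8 by (simp add: \<alpha>_def \<rho>_def)
        also have "exp \<dots> = \<rho> ^ a'" using \<rho> by (simp add: exp_of_nat_mult)
        finally show ?thesis .
      qed
      ultimately show ?thesis using \<rho> Suc by simp
    qed
    show ?thesis
    proof (rule onorm_bound)
      show "0 \<le> C * real n powr \<alpha>" using K0 A0 by (simp add: C_def)
    next
      fix x
      \<comment> \<open>The \<open>n\<close>-th power is the first coefficient of a window of length
        \<open>N ^ a\<close> that starts at \<open>n\<close>, which is at most the square of this
        length.\<close>
      have "norm ((T ^^ nat (int n)) x) \<le> 2 * B\<^sup>2 * Lp_norm p (trig_poly {int n..<int n + int (N ^ a)} (\<lambda>l. (T ^^ nat l) x))"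
        using norm_coeff_le[of "{int n..<int n + int (N ^ a)}" "int n" "\<lambda>l. (T ^^ nat l) x"] N_ge_8 by simp
      also have "\<dots> \<le> 2 * B\<^sup>2 * (10 * B\<^sup>2 * (K + 1) * Lp_norm p (trig_poly {0..<int (N ^ Suc a)} (\<lambda>l. (T ^^ nat l) x)))"
        using a N_ge_8 by (intro mult_left_mono Kreiss_window[OF T]) (simp_all add: power_even_eq)
      also have "\<dots> \<le> 2 * B\<^sup>2 * (10 * B\<^sup>2 * (K + 1) * (A * \<rho> ^ Suc a * norm x))"
        using K0 by (intro mult_left_mono A[OF T]) auto
      also have "\<dots> = (2 * B\<^sup>2 * (10 * B\<^sup>2 * (K + 1)) * A * \<rho> * norm x) * \<rho> ^ a" by simp
      also have "\<dots> \<le> (2 * B\<^sup>2 * (10 * B\<^sup>2 * (K + 1)) * A * \<rho> * norm x) * (\<rho> * real n powr \<alpha>)"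
        using K0 A0 \<rho> by (intro mult_left_mono \<rho>a) auto
      also have "\<dots> = C * real n powr \<alpha> * norm x" by (simp add: C_def power2_eq_square mult_ac)
      finally show "norm ((T ^^ n) x) \<le> C * real n powr \<alpha> * norm x" by simp
    qed
  qed
  then show ?thesis by (rule that)
qed

end

theorem corollary3p2:
  assumes "UMD TYPE('a::complex_banach)"
  shows "\<exists>\<alpha>::real. 0 \<le> \<alpha> \<and> \<alpha> < 1/2 \<and>
    (\<forall>K::real. \<exists>C::real. \<forall>T::'a \<Rightarrow> 'a. strongly_Kreiss_bounded K T \<longrightarrow>
       (\<forall>n\<ge>1. onorm (T ^^ n) \<le> C * real n powr \<alpha>))"
proof -
  obtain p B where "riesz_bounded TYPE('a) p B"
    using UMD_imp_riesz_bounded[OF assms] .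
  then interpret riesz_bounded p B "TYPE('a)" .
  obtain N where "block_bounded TYPE('a) p B N"
  proof (rule ex_block_estimate)
    fix N :: nat
    assume N8: "N \<ge> 8" and blocks: "\<And>m (x :: int \<Rightarrow> 'a) M. mono m \<Longrightarrow> (\<And>j. j < N \<Longrightarrow> Lp_norm p (trig_poly {m j..<m (Suc j)} x) \<le> M)
      \<Longrightarrow> Lp_norm p (trig_poly {m 0..<m N} x) \<le> real N / 2 * M"
    have "block_bounded TYPE('a) p B N"
      by unfold_locales (rule N8, blast intro: blocks)
    then show thesis by (rule that)
  qed
  then interpret block_bounded p B "TYPE('a)" N .
  \<comment> \<open>\<open>N\<close> was obtained from the space alone, so this exponent is fixed
    before \<open>K\<close>; it is below 1/2 because the base 3/4 is below 1.\<close>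
  define \<alpha> where "\<alpha> = ln (3 / 4 * real N) / (2 * ln (real N))"
  have "ln (3 / 4 * real N) < ln (real N)" "ln (3 / 4 * real N) \<ge> 0" "ln (real N) > 0"
    using N_ge_8 by auto
  then have "0 \<le> \<alpha>" "\<alpha> < 1/2" by (auto simp: \<alpha>_def divide_less_eq)
  moreover have "\<exists>C. \<forall>T::'a \<Rightarrow> 'a. strongly_Kreiss_bounded K T \<longrightarrow> (\<forall>n\<ge>1. onorm (T ^^ n) \<le> C * real n powr \<alpha>)" for K
  proof (rule Kreiss_power_growth[of K])
    fix C assume "\<And>(T :: 'a \<Rightarrow> 'a) n. strongly_Kreiss_bounded K T \<Longrightarrow> n \<ge> 1 \<Longrightarrow>
      onorm (T ^^ n) \<le> C * real n powr (ln (3 / 4 * real N) / (2 * ln (real N)))"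
    then show ?thesis unfolding \<alpha>_def by blast
  qed
  ultimately show ?thesis by blast
qed

end
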